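(* Let $\mathcal D(dP|\theta H)$ denote the law of a Dirichlet process with shape $\theta H$, and let $g$ be a positive measurable function on $\mathcal Y$ satisfying $\int_{\mathcal Y}\log[1+g(y)]\,\theta H(dy)<\infty$. Let $z\ge 0$. Then the following hold. (i) For any positive $q$ and $\theta$, $$\int_{\mathcal M}(1+zP(g))^{-q}\,\mathcal D(dP|\theta H)=\int_{\mathcal M}e^{-z\mu(g)}\,\mathcal{BG}(d\mu|\theta H,\theta-q).$$ (ii) For any positive $q$ and $\theta$, and any integer $n\ge 0$ satisfying $\theta+n-q>0$, both sides of the identity in (i) are equal to $$\sum_{\mathbf p}\pi(\mathbf p|\theta)\int_0^1 e^{-\int_{\mathcal Y}\log[1+uzg(y)]\,\theta H(dy)}\left[\prod_{j=1}^{n(\mathbf p)}\int_{\mathcal Y}(1+uzg(y))^{-e_{j,n}}H(dy)\right]\mathcal B(du|q,\theta+n-q),$$ where the sum is over all partitions $\mathbf p$ of $\{1,\dots,n\}$. In particular, for the gamma process with shape $\theta H$, its Laplace functional $\int_{\mathcal M}e^{-z\mu(g)}\,\mathcal G(d\mu|\theta H)$ is given by this expression with $q=\theta$, for all $n\ge 1$. (iii) When $\theta-q>0$, $$\int_{\mathcal M}(1+zP(g))^{-q}\,\mathcal D(dP|\theta H)=\int_0^1 e^{-\int_{\mathcal Y}\log[1+uzg(y)]\,\theta H(dy)}\,\mathcal B(du|q,\theta-q).$$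
   Context: $\mathcal Y$ is a Polish space, $\mathcal M$ is the space of boundedly finite measures on $\mathcal Y$, $H$ is a fixed non-atomic probability measure on $\mathcal Y$ and $\theta>0$. For a measure $\mu$ and function $g$, $\mu(g)=\int_{\mathcal Y}g(y)\mu(dy)$. Gamma process: $\mathcal G(d\mu|\theta H)$ is the law on $\mathcal M$ of the gamma process $\mu$ with shape $\theta H$, i.e. the random measure with independent values on disjoint sets and $\mu(A)$ gamma distributed with shape $\theta H(A)$ and scale $1$; its Laplace functional is $\int_{\mathcal M}e^{-\mu(g)}\mathcal G(d\mu|\theta H)=\exp\{-\int_{\mathcal Y}\log[1+g(y)]\theta H(dy)\}$. Write $T=\mu(\mathcal Y)$. Dirichlet process: $\mathcal D(dP|\theta H)$ is the law of the random probability measure $P=\mu/T$ when $\mu$ has law $\mathcal G(d\mu|\theta H)$. Beta-gamma process: for $\theta,q>0$, $$\mathcal{BG}(d\mu|\theta H,\theta-q)=\frac{\Gamma(\theta)}{\Gamma(q)}T^{-(\theta-q)}\mathcal G(d\mu|\theta H),$$ a probability law on $\mathcal M$; for $q=\theta$ it is $\mathcal G(d\mu|\theta H)$. Beta law: $\mathcal B(du|a,b)=\frac{\Gamma(a+b)}{\Gamma(a)\Gamma(b)}u^{a-1}(1-u)^{b-1}du$ on $0<u<1$. Partitions: $\mathbf p=\{C_1,\dots,C_{n(\mathbf p)}\}$ denotes a partition of $\{1,\dots,n\}$ into $n(\mathbf p)$ nonempty cells, $e_{j,n}$ is the size of $C_j$, and $$\pi(\mathbf p|\theta)=\frac{\Gamma(\theta)}{\Gamma(\theta+n)}\theta^{n(\mathbf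 p)}\prod_{j=1}^{n(\mathbf p)}\Gamma(e_{j,n}).$$ For $n=0$ there is only the empty partition, with $\pi=1$ and empty product equal to $1$. *)

theory Defs
  imports "HOL-Probability.Probability"
begin

text \<open>
  The space of boundedly finite Borel measures, with the \<open>\<sigma>\<close>-algebra generated by the
  evaluations \<open>\<mu> \<mapsto> \<mu>(A)\<close>, \<open>A\<close> Borel.  Boundedness refers to the complete metric of the
  class \<open>polish_space\<close>.
\<close>
definition bdd_fin_algebra :: "('y::polish_space) measure measure" where
  "bdd_fin_algebra =
     (SUP A \<in> sets borel.
        vimage_algebra
          {\<mu>. sets \<mu> = sets borel \<and> (\<forall>B\<in>sets borel. bounded B \<longrightarrow> emeasure \<mu> B < \<infinity>)}
          (\<lambda>\<mu>. emeasure \<mu> A) borel)"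

definition non_atomic :: "'a measure \<Rightarrow> bool" where
  "non_atomic M \<longleftrightarrow>
     (\<forall>A\<in>sets M. 0 < emeasure M A \<longrightarrow>
        (\<exists>B\<in>sets M. B \<subseteq> A \<and> 0 < emeasure M B \<and> emeasure M B < emeasure M A))"

text \<open>Scale 1; shape \<open>a = 0\<close> is the point mass at 0, as needed for \<open>\<alpha>\<close>-null sets below.\<close>
definition gamma_distribution :: "real \<Rightarrow> real measure" where
  "gamma_distribution a =
     (if a = 0 then return borel 0
      else density lborel
        (\<lambda>x. ennreal (x powr (a - 1) * exp (- x) / Gamma a * indicator {0<..} x)))"

definition beta_distribution :: "real \<Rightarrow> real \<Rightarrow> real measure" where
  "beta_distribution a b =
     density lborel
       (\<lambda>u. ennreal (Gamma (a + b) / (Gamma a * Gamma b) * u powr (a - 1) * (1 - u) powr (b - 1)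
              * indicator {0<..<1} u))"

text \<open>
  \<open>G\<close> is the law of the gamma process with (finite) shape measure \<open>\<alpha>\<close>.  The distribution of
  \<open>\<mu>(A)\<close> is specified on \<open>[0,\<infinity>]\<close>, which in particular makes \<open>\<mu>(A)\<close> almost surely finite.  A
  finite disjoint family is extended to a sequence by empty sets.
\<close>
definition gamma_process_law :: "('y::polish_space) measure \<Rightarrow> 'y measure measure \<Rightarrow> bool" where
  "gamma_process_law \<alpha> G \<longleftrightarrow>
     prob_space G \<and> sets G = sets bdd_fin_algebra \<and>
     (\<forall>A\<in>sets borel.
        distr G borel (\<lambda>\<mu>. emeasure \<mu> A) =
        distr (gamma_distribution (measure \<alpha> A)) borel ennreal) \<and>
     (\<forall>A :: nat \<Rightarrow> 'y set. range A \<subseteq> sets borel \<longrightarrow> disjoint_family A \<longrightarrow>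
        prob_space.indep_vars G (\<lambda>_. borel) (\<lambda>i \<mu>. emeasure \<mu> (A i)) UNIV)"

text \<open>
  The law of \<open>P = \<mu>/T\<close>, \<open>T = \<mu>(\<Y>)\<close>.  On the null event \<open>T \<in> {0, \<infinity>}\<close> the value is the zero
  measure.
\<close>
definition dirichlet_law :: "('y::polish_space) measure measure \<Rightarrow> 'y measure measure" where
  "dirichlet_law G =
     distr G bdd_fin_algebra (\<lambda>\<mu>. scale_measure (inverse (emeasure \<mu> UNIV)) \<mu>)"

text \<open>
  For \<open>G\<close> the gamma process law with shape \<open>\<theta>H\<close>, this is the beta-gamma law written
  \<open>\<B>\<G>(d\<mu> | \<theta>H, \<theta> - q)\<close>; note that the argument here is \<open>q\<close>.
\<close>
definition beta_gamma_law ::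
    "('y::polish_space) measure measure \<Rightarrow> real \<Rightarrow> real \<Rightarrow> 'y measure measure" where
  "beta_gamma_law G \<theta> q =
     density G (\<lambda>\<mu>. ennreal (Gamma \<theta> / Gamma q * measure \<mu> UNIV powr (- (\<theta> - q))))"

text \<open>The weight \<open>\<pi>(p | \<theta>)\<close> of a partition \<open>p\<close> of \<open>{1..n}\<close>.\<close>
definition partition_weight :: "real \<Rightarrow> nat \<Rightarrow> nat set set \<Rightarrow> real" where
  "partition_weight \<theta> n p =
     Gamma \<theta> / Gamma (\<theta> + real n) * \<theta> ^ card p * (\<Prod>C\<in>p. Gamma (real (card C)))"

definition partition_beta_sum ::
    "('y::polish_space) measure \<Rightarrow> real \<Rightarrow> ('y \<Rightarrow> real) \<Rightarrow> real \<Rightarrow> real \<Rightarrow> nat \<Rightarrow> real" where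
  "partition_beta_sum H \<theta> g z q n =
     (\<Sum>p \<in> {p. partition_on {1..n} p}.
        partition_weight \<theta> n p *
        (\<integral>u. exp (- (\<integral>y. ln (1 + u * z * g y) \<partial>scale_measure (ennreal \<theta>) H)) *
             (\<Prod>C\<in>p. \<integral>y. (1 + u * z * g y) powr (- real (card C)) \<partial>H)
           \<partial>beta_distribution q (\<theta> + real n - q)))"

end

theory Submission
  imports Defs
begin

text \<open>
  Write \<open>T = \<mu>(\<Y>)\<close> and \<open>f = z g\<close>, so that \<open>z P(g) = \<mu>(f) / T\<close>.  Everything rests on the joint Laplace
  transform of \<open>T\<close> and \<open>\<mu>(f)\<close> under the gamma process with shape \<open>\<alpha> = \<theta>H\<close>,
  \<open>E exp(- s T - \<mu>(f)) = exp (- \<integral> log(1 + s + f) d\<alpha>)\<close>.  It holds for simple functions by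
  independence over disjoint sets, and in general by monotone limits
  (\<open>laplace_functional\<close>); along the way \<open>\<mu>(f)\<close> is seen to be almost surely finite.

  Differentiating \<open>n\<close> times in \<open>s\<close> produces the partitions.  The exponential contributes the factor
  \<open>\<integral> (1 + s + f)\<^sup>-\<^sup>1 d\<alpha>\<close>, which opens a new cell, and each factor
  \<open>\<Gamma>(e) \<integral> (1 + s + f)\<^sup>-\<^sup>e d\<alpha>\<close> turns into the one with \<open>e + 1\<close>, which enlarges a cell.  These are the
  two ways to extend a partition of \<open>{1..n}\<close> to one of \<open>{1..n+1}\<close>, so \<open>E[T\<^sup>n exp(- s T - \<mu>(f))]\<close>
  is an explicit sum over partitions (\<open>total_mass_moment\<close>).  That sum is homogeneous in
  \<open>(1 + s, f)\<close>, of degree \<open>- \<theta> - n\<close> (\<open>partition_moment_scale\<close>).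

  Real powers of \<open>T\<close> are reached from integer ones by
  \<open>\<Gamma>(b) T\<^sup>-\<^sup>b = \<integral> r\<^sup>b\<^sup>-\<^sup>1 exp(- r T) dr\<close> over \<open>r > 0\<close> (\<open>nn_integral_powr_mixture\<close>).

  For the identity between the Dirichlet and the beta-gamma side, the usual argument uses that \<open>T\<close> and
  \<open>P\<close> are independent.  Here the homogeneity takes over that role: it gives
  \<open>E[T\<^sup>q exp(- t (T + \<mu>(f)))] = t powr (- \<theta> - q) E[T\<^sup>q exp(- T / t - \<mu>(f))]\<close> (\<open>tilted_scaling\<close>).
  Integrating the left side against \<open>t powr (q - 1)\<close> gives \<open>\<Gamma>(q) E[(1 + P(f)) powr (- q)]\<close>; integrating the
  right side, after \<open>t = 1/r\<close>, gives \<open>\<Gamma>(\<theta>) E[T powr (q - \<theta>) exp(- \<mu>(f))]\<close> (\<open>nn_ratio_identity\<close>).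

  The partition formula comes from writing \<open>T powr (q - \<theta>) = T\<^sup>n T\<^sup>-\<^sup>b\<close> with \<open>b = \<theta> + n - q > 0\<close> in the
  beta-gamma expectation and substituting \<open>u = 1/(1 + r)\<close> in the mixture, which turns the weight
  \<open>r\<^sup>b\<^sup>-\<^sup>1\<close> into the beta density (\<open>nn_partition_identity\<close>).  The case \<open>n = 0\<close> is part (iii), and
  \<open>q = \<theta>\<close> is the gamma process.

  Expectations are computed as integrals in \<open>[0,\<infinity>]\<close>, where Tonelli's theorem applies freely, and are
  turned into real integrals at the end; all values are finite because \<open>(1 + P(f)) powr (- q) \<le> 1\<close>.
\<close>

section \<open>Gamma integrals, inversion and differentiation under the integral\<close>

lemma nn_integral_Gamma_scaled:
  fixes a c :: real
  assumes "a > 0" "c > 0"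
  shows "(\<integral>\<^sup>+t. ennreal (t powr (a - 1) * exp (- (c * t))) * indicator {0<..} t \<partial>lborel)
           = ennreal (Gamma a * c powr (- a))"
proof -
  have "ennreal (Gamma a) = (\<integral>\<^sup>+t. ennreal (indicator {0..} t * t powr (a - 1) / exp t) \<partial>lborel)"
    by (rule Gamma_conv_nn_integral_real) fact
  also have "\<dots> = (\<integral>\<^sup>+t. ennreal (t powr (a - 1) * exp (- t)) * indicator {0<..} t \<partial>lborel)"
    by (intro nn_integral_cong) (auto simp: indicator_def exp_minus field_simps)
  also have "\<dots> = ennreal \<bar>c\<bar> *
      (\<integral>\<^sup>+t. ennreal ((0 + c * t) powr (a - 1) * exp (- (0 + c * t))) * indicator {0<..} (0 + c * t) \<partial>lborel)"
    using assms by (intro nn_integral_real_affine) auto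
  also have "\<dots> = (\<integral>\<^sup>+t. ennreal (c powr a) *
      (ennreal (t powr (a - 1) * exp (- (c * t))) * indicator {0<..} t) \<partial>lborel)"
  proof (subst nn_integral_cmult[symmetric], simp, rule nn_integral_cong)
    fix t :: real
    have "c * (c * t) powr (a - 1) = c powr a * t powr (a - 1)" if "t > 0"
      using assms that by (simp add: powr_mult powr_diff)
    then have "c * ((c * t) powr (a - 1) * exp (- (c * t))) = c powr a * (t powr (a - 1) * exp (- (c * t)))"
      if "t > 0" using that by (simp add: mult.assoc[symmetric])
    then show "ennreal \<bar>c\<bar> * (ennreal ((0 + c * t) powr (a - 1) * exp (- (0 + c * t))) * indicator {0<..} (0 + c * t)) =
        ennreal (c powr a) * (ennreal (t powr (a - 1) * exp (- (c * t))) * indicator {0<..} t)"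
      using assms by (auto simp: indicator_def zero_less_mult_iff simp flip: ennreal_mult)
  qed
  also have "\<dots> = ennreal (c powr a) *
      (\<integral>\<^sup>+t. ennreal (t powr (a - 1) * exp (- (c * t))) * indicator {0<..} t \<partial>lborel)"
    by (rule nn_integral_cmult) auto
  finally have *: "ennreal (Gamma a) = \<dots>" .
  have "ennreal (Gamma a * c powr (- a)) = ennreal (c powr (- a)) * ennreal (Gamma a)"
    using assms by (subst ennreal_mult[symmetric]) (auto simp: mult.commute Gamma_real_pos less_imp_le)
  also have "\<dots> = (ennreal (c powr (- a)) * ennreal (c powr a)) *
      (\<integral>\<^sup>+t. ennreal (t powr (a - 1) * exp (- (c * t))) * indicator {0<..} t \<partial>lborel)"
    by (simp add: * mult.assoc)
  also have "ennreal (c powr (- a)) * ennreal (c powr a) = 1"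
    using assms by (simp add: ennreal_mult[symmetric] powr_add[symmetric])
  finally show ?thesis by simp
qed

text \<open>
  A constant bound on the derivative suffices on a finite measure space: by the mean value theorem it
  dominates the difference quotients.
\<close>
lemma (in finite_measure) has_real_derivative_integral:
  fixes f f' :: "real \<Rightarrow> 'a \<Rightarrow> real"
  assumes S: "open S" "convex S" "s0 \<in> S"
    and int: "\<And>s. s \<in> S \<Longrightarrow> integrable M (f s)"
    and der: "\<And>s x. s \<in> S \<Longrightarrow> x \<in> space M \<Longrightarrow> ((\<lambda>s. f s x) has_real_derivative f' s x) (at s)"
    and bd: "\<And>s x. s \<in> S \<Longrightarrow> x \<in> space M \<Longrightarrow> \<bar>f' s x\<bar> \<le> B"
  shows "((\<lambda>s. \<integral>x. f s x \<partial>M) has_real_derivative (\<integral>x. f' s0 x \<partial>M)) (at s0)"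
  unfolding has_field_derivative_iff
proof (subst tendsto_at_iff_sequentially, intro allI impI)
  fix X :: "nat \<Rightarrow> real"
  assume X: "\<forall>i. X i \<in> UNIV - {s0}" "X \<longlonglongrightarrow> s0"
  have "\<forall>\<^sub>F i in sequentially. X i \<in> S"
    using X(2) S by (simp add: topological_tendstoD)
  then obtain N where N: "\<And>i. i \<ge> N \<Longrightarrow> X i \<in> S" by (auto simp: eventually_sequentially)
  define Z where "Z i = X (i + N)" for i
  have Z: "Z i \<in> S" "Z i \<noteq> s0" for i using N X(1) by (auto simp: Z_def)
  have Zlim: "Z \<longlonglongrightarrow> s0" unfolding Z_def using X(2) by (rule LIMSEQ_ignore_initial_segment)
  define D where "D i x = (f (Z i) x - f s0 x) / (Z i - s0)" for i x
  have D_meas: "D i \<in> borel_measurable M" for i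
    using int[OF Z(1)[of i]] int[OF S(3)] unfolding D_def by auto
  have D_lim: "(\<lambda>i. D i x) \<longlonglongrightarrow> f' s0 x" if "x \<in> space M" for x
  proof -
    have "((\<lambda>s. (f s x - f s0 x) / (s - s0)) \<longlongrightarrow> f' s0 x) (at s0)"
      using der[OF S(3) that] by (simp add: has_field_derivative_iff)
    then show ?thesis
      unfolding tendsto_at_iff_sequentially D_def using Z Zlim by (auto simp: o_def)
  qed
  have D_bd: "norm (D i x) \<le> B" if "x \<in> space M" for i x
  proof -
    have "norm (f (Z i) x - f s0 x) \<le> B * norm (Z i - s0)"
      using S Z bd that der[OF _ that]
      by (intro field_differentiable_bound[where S = S and f' = "\<lambda>s. f' s x"])
         (auto intro: has_field_derivative_at_within)
    then show ?thesis using Z(2)[of i] by (simp add: D_def field_simps)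
  qed
  have f'_meas: "f' s0 \<in> borel_measurable M"
    by (rule borel_measurable_LIMSEQ_real[OF _ D_meas]) (rule D_lim)
  have "(\<lambda>i. \<integral>x. D i x \<partial>M) \<longlonglongrightarrow> (\<integral>x. f' s0 x \<partial>M)"
    by (rule integral_dominated_convergence[where w = "\<lambda>_. B"])
       (use f'_meas D_meas D_lim D_bd in auto)
  moreover have "(\<integral>x. D i x \<partial>M) = ((\<integral>x. f (Z i) x \<partial>M) - (\<integral>x. f s0 x \<partial>M)) / (Z i - s0)" for i
    using int[OF Z(1)[of i]] int[OF S(3)] by (simp add: D_def)
  ultimately have "(\<lambda>i. ((\<integral>x. f (X (i + N)) x \<partial>M) - (\<integral>x. f s0 x \<partial>M)) / (X (i + N) - s0))
      \<longlonglongrightarrow> (\<integral>x. f' s0 x \<partial>M)"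
    by (simp add: Z_def)
  then show "((\<lambda>y. ((\<integral>x. f y x \<partial>M) - (\<integral>x. f s0 x \<partial>M)) / (y - s0)) \<circ> X) \<longlonglongrightarrow> (\<integral>x. f' s0 x \<partial>M)"
    unfolding o_def by (rule LIMSEQ_offset)
qed



text \<open>
  The substitution rule used here needs an increasing map on a compact interval; it is applied to
  \<open>x \<mapsto> - 1 / x\<close> on \<open>[- K, - 1 / K]\<close>, followed by a reflection and the limit \<open>K \<rightarrow> \<infinity>\<close>.
\<close>
lemma nn_integral_inversion:
  fixes F :: "real \<Rightarrow> ennreal"
  assumes [measurable]: "F \<in> borel_measurable borel"
  shows "(\<integral>\<^sup>+t. F t * indicator {0<..} t \<partial>lborel) =
         (\<integral>\<^sup>+t. F (1 / t) * ennreal (1 / t\<^sup>2) * indicator {0<..} t \<partial>lborel)"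
proof -
  define B where "B k = {1 / (real k + 2) .. real k + 2}" for k :: nat
  have B_sets [measurable]: "B k \<in> sets borel" for k by (simp add: B_def)
  have mono: "incseq B"
    by (rule incseq_SucI) (auto simp: B_def field_simps intro: order_trans[rotated])
  have UN: "(\<Union>k. B k) = {0<..}"
  proof (rule equalityI; rule subsetI)
    fix t :: real assume t: "t \<in> {0<..}"
    obtain k :: nat where k: "max t (1 / t) < real k" using reals_Archimedean2 by blast
    with t have "t \<in> B k" by (auto simp: B_def field_simps)
    then show "t \<in> (\<Union>k. B k)" by blast
  next
    fix t assume "t \<in> (\<Union>k. B k)"
    then obtain k where "1 / (real k + 2) \<le> t" by (auto simp: B_def)
    moreover have "0 < 1 / (real k + 2)" by simp
    ultimately have "0 < t" by linarith
    then show "t \<in> {0<..}" by simp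
  qed
  have exhaust: "(\<integral>\<^sup>+t. f t * indicator {0<..} t \<partial>lborel) = (SUP k. \<integral>\<^sup>+t. f t * indicator (B k) t \<partial>lborel)"
    if [measurable]: "f \<in> borel_measurable borel" for f :: "real \<Rightarrow> ennreal"
  proof -
    have "(SUP k. emeasure (density lborel f) (B k)) = emeasure (density lborel f) (\<Union>k. B k)"
      by (rule SUP_emeasure_incseq) (use mono in auto)
    then show ?thesis unfolding UN by (simp add: emeasure_density)
  qed
  have piece: "(\<integral>\<^sup>+t. F t * indicator (B k) t \<partial>lborel) =
      (\<integral>\<^sup>+t. F (1 / t) * ennreal (1 / t\<^sup>2) * indicator (B k) t \<partial>lborel)" for k
  proof -
    define K where "K = real k + 2"
    have K: "K > 1" by (simp add: K_def)
    have "1 < K * K" using K by (simp add: less_1_mult)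
    then have lt: "- K < - (1 / K)" using K by (simp add: field_simps)
    have neg: "x < 0" if "x \<le> - (1 / K)" for x
      using that K by (smt (verit) divide_pos_pos)
    have "(\<integral>\<^sup>+t. F t * indicator {- 1 / (- K) .. - 1 / (- (1 / K))} t \<partial>lborel) =
          (\<integral>\<^sup>+t. F (- 1 / t) * ennreal (1 / t\<^sup>2) * indicator {- K .. - (1 / K)} t \<partial>lborel)"
      by (rule nn_integral_substitution_aux)
         (use lt neg in \<open>auto intro!: derivative_eq_intros continuous_intros dest: neg simp: power2_eq_square\<close>)
    also have "\<dots> = ennreal \<bar>- 1\<bar> * (\<integral>\<^sup>+t. F (- 1 / (0 + (- 1) * t)) * ennreal (1 / (0 + (- 1) * t)\<^sup>2)
                 * indicator {- K .. - (1 / K)} (0 + (- 1) * t) \<partial>lborel)"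
      by (rule nn_integral_real_affine) auto
    also have "\<dots> = (\<integral>\<^sup>+t. F (1 / t) * ennreal (1 / t\<^sup>2) * indicator (B k) t \<partial>lborel)"
      by (auto intro!: nn_integral_cong simp: B_def K_def indicator_def)
    finally show ?thesis using K by (simp add: B_def flip: K_def)
  qed
  have "(\<integral>\<^sup>+t. F t * indicator {0<..} t \<partial>lborel) = (SUP k. \<integral>\<^sup>+t. F t * indicator (B k) t \<partial>lborel)"
    by (rule exhaust) simp
  also have "\<dots> = (SUP k. \<integral>\<^sup>+t. F (1 / t) * ennreal (1 / t\<^sup>2) * indicator (B k) t \<partial>lborel)"
    by (simp add: piece)
  also have "\<dots> = (\<integral>\<^sup>+t. F (1 / t) * ennreal (1 / t\<^sup>2) * indicator {0<..} t \<partial>lborel)"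
    by (rule exhaust[symmetric]) simp
  finally show ?thesis .
qed



section \<open>Partitions of a set with one more element\<close>

text \<open>
  A partition of \<open>insert a A\<close> is a partition \<open>p\<close> of \<open>A\<close> together with the set \<open>C\<close> that \<open>a\<close> joins.  Allowing
  \<open>C = {}\<close> makes the case where \<open>a\<close> forms a cell of its own an instance of the general one, so that a
  single bijection \<open>(p, C) \<mapsto> insert (insert a C) (p - {C})\<close> serves for both.
\<close>
lemma sum_partitions_insert:
  fixes \<kappa> :: "nat \<Rightarrow> 'b::comm_ring_1"
  assumes A: "finite A" "a \<notin> A"
  shows "(\<Sum>p \<in> {p. partition_on (insert a A) p}. \<Prod>C\<in>p. \<kappa> (card C)) =
         (\<Sum>p \<in> {p. partition_on A p}.
            \<kappa> 1 * (\<Prod>C\<in>p. \<kappa> (card C)) + (\<Sum>C\<in>p. \<kappa> (card C + 1) * (\<Prod>D\<in>p - {C}. \<kappa> (card D))))"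
    (is "?L = ?R")
proof -
  let ?P = "{p. partition_on A p}" and ?P' = "{p. partition_on (insert a A) p}"
  define w where "w p C = \<kappa> (card C + 1) * (\<Prod>D\<in>p - {C}. \<kappa> (card D))" for p and C :: "'a set"
  have fin: "finite p" "finite C" "a \<notin> C" if "partition_on A p" "C \<in> insert {} p" for p C
    using that A finite_elements[of A p] by (auto simp: partition_on_def intro: finite_subset)
  have "?R = (\<Sum>p \<in> ?P. \<Sum>C\<in>insert {} p. w p C)"
  proof (rule sum.cong[OF refl])
    fix p assume p: "p \<in> ?P"
    then have "{} \<notin> p" "finite p" using fin(1)[of p "{}"] by (auto simp: partition_on_def)
    then show "\<kappa> 1 * (\<Prod>C\<in>p. \<kappa> (card C)) + (\<Sum>C\<in>p. \<kappa> (card C + 1) * (\<Prod>D\<in>p - {C}. \<kappa> (card D))) =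
        (\<Sum>C\<in>insert {} p. w p C)"
      by (simp add: w_def)
  qed
  also have "\<dots> = (\<Sum>(p, C) \<in> Sigma ?P (insert {}). w p C)"
    by (rule sum.Sigma) (use A fin(1) in \<open>auto simp: finitely_many_partition_on\<close>)
  also have "\<dots> = ?L"
  proof (rule sum.reindex_bij_witness
      [where j = "\<lambda>(p, C). insert (insert a C) (p - {C})"
         and i = "\<lambda>p. ((\<lambda>D. D - {a}) ` p - {{}}, (THE D. D \<in> p \<and> a \<in> D) - {a})"])
    fix x assume x: "x \<in> Sigma ?P (insert {})"
    obtain p C where xp: "x = (p, C)" "partition_on A p" "C \<in> insert {} p" using x by auto
    note f = fin[OF xp(2,3)]
    have e: "{} \<notin> p" using xp(2) by (rule partition_onD3)
    have aD: "a \<notin> D" if "D \<in> p" for D using A(2) partition_onD1[OF xp(2)] that by blast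
    have CD: "C \<inter> D = {}" if "D \<in> p - {C}" for D
    proof (cases "C = {}")
      case False
      then have "C \<in> p" using xp(3) by simp
      then show ?thesis using that partition_onD2[OF xp(2)] by (auto dest: disjointD)
    qed simp
    have disj: "disjnt (insert a C) (\<Union>(p - {C}))"
      unfolding disjnt_Union2 using aD CD by (simp add: disjnt_def)
    have new: "insert a C \<notin> p - {C}" using aD by blast
    have A': "partition_on (A - C) (p - {C}) \<and> C \<subseteq> A"
    proof (cases "C = {}")
      case True then show ?thesis using xp(2) e by simp
    next
      case False
      then have C: "C \<in> p" using xp(3) by simp
      have "disjnt C (\<Union>(p - {C}))" using disj by simp
      then show ?thesis using xp(2) partition_on_insert[of C "p - {C}" A] C by (simp add: insert_absorb)
    qed
    moreover have "insert a A - insert a C = A - C" using A by auto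
    ultimately have "partition_on (insert a A) (insert (insert a C) (p - {C}))"
      by (subst partition_on_insert[OF disj]) auto
    then show "(\<lambda>(p, C). insert (insert a C) (p - {C})) x \<in> ?P'" by (simp add: xp(1))
    have cell: "(THE D. D \<in> insert (insert a C) (p - {C}) \<and> a \<in> D) = insert a C"
      by (rule the_equality) (use aD in blast)+
    have "(\<lambda>D. D - {a}) ` (p - {C}) = (\<lambda>D. D) ` (p - {C})"
      by (rule image_cong) (use aD in auto)
    moreover have "insert a C - {a} = C" using f(3) by simp
    ultimately have "(\<lambda>D. D - {a}) ` insert (insert a C) (p - {C}) - {{}} = insert C (p - {C}) - {{}}"
      by (simp only: image_insert image_ident)
    also have "\<dots> = p" using xp(3) e by auto
    finally show "(\<lambda>p. ((\<lambda>D. D - {a}) ` p - {{}}, (THE D. D \<in> p \<and> a \<in> D) - {a}))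
        ((\<lambda>(p, C). insert (insert a C) (p - {C})) x) = x"
      using f(3) by (simp only: xp(1) prod.case cell) simp
    show "(\<Prod>C\<in>(case x of (p, C) \<Rightarrow> insert (insert a C) (p - {C})). \<kappa> (card C)) = (case x of (p, C) \<Rightarrow> w p C)"
      using f new by (simp add: xp(1) w_def)
  next
    fix p assume "p \<in> ?P'"
    then have p: "partition_on (insert a A) p" by simp
    then have "a \<in> \<Union>p" using partition_onD1 by blast
    then obtain E where E: "E \<in> p" "a \<in> E" by blast
    have disj: "D \<inter> E = {}" if "D \<in> p" "D \<noteq> E" for D
      using that E partition_onD2[OF p] by (auto dest: disjointD)
    have uniq: "D = E" if "D \<in> p" "a \<in> D" for D
      using disj[OF that(1)] that E by blast
    have cell: "(THE D. D \<in> p \<and> a \<in> D) = E"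
      by (rule the_equality) (use E uniq in blast)+
    have "(\<lambda>D. D - {a}) ` (p - {E}) = (\<lambda>D. D) ` (p - {E})"
      by (rule image_cong) (use uniq in auto)
    moreover have "insert E (p - {E}) = p" using E by auto
    ultimately have imgp: "(\<lambda>D. D - {a}) ` p = insert (E - {a}) (p - {E})"
      using image_insert[of "\<lambda>D. D - {a}" E "p - {E}"] by simp
    have e: "{} \<notin> p" using p by (rule partition_onD3)
    have nin: "E - {a} \<notin> p - {E}"
    proof
      assume *: "E - {a} \<in> p - {E}"
      then have "(E - {a}) \<inter> E = {}" using disj by blast
      then have "E - {a} = {}" by blast
      with * e show False by simp
    qed
    have "(\<Union>D\<in>p. D - {a}) = \<Union>p - {a}" by blast
    then have "partition_on (insert a A - {a}) ((\<lambda>D. D - {a}) ` p - {{}})"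
      by (intro partition_on_transform[OF p, of "\<lambda>D. D - {a}"]) (auto simp: disjnt_def)
    moreover have "insert a A - {a} = A" using A by simp
    ultimately have "partition_on A ((\<lambda>D. D - {a}) ` p - {{}})" by simp
    moreover have "E - {a} \<in> insert {} ((\<lambda>D. D - {a}) ` p - {{}})" using E by blast
    ultimately show "(\<lambda>p. ((\<lambda>D. D - {a}) ` p - {{}}, (THE D. D \<in> p \<and> a \<in> D) - {a})) p \<in> Sigma ?P (insert {})"
      by (simp only: cell mem_Sigma_iff mem_Collect_eq)
    have "insert a (E - {a}) = E" using E by auto
    moreover have "insert E ((insert (E - {a}) (p - {E}) - {{}}) - {E - {a}}) = p"
    proof (cases "E - {a} = {}")
      case True show ?thesis unfolding True using e E(1) by auto
    next
      case False then show ?thesis using nin e E(1) by auto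
    qed
    ultimately show "(\<lambda>(p, C). insert (insert a C) (p - {C}))
        ((\<lambda>p. ((\<lambda>D. D - {a}) ` p - {{}}, (THE D. D \<in> p \<and> a \<in> D) - {a})) p) = p"
      by (simp only: cell imgp prod.case)
  qed
  finally show ?thesis ..
qed

section \<open>Measurability on the space of boundedly finite measures\<close>

lemma space_bdd_fin_algebra:
  "space bdd_fin_algebra =
     {\<mu>::'y::polish_space measure. sets \<mu> = sets borel \<and> (\<forall>B\<in>sets borel. bounded B \<longrightarrow> emeasure \<mu> B < \<infinity>)}"
proof -
  have "{} \<in> sets (borel :: 'y measure)" by simp
  then show ?thesis unfolding bdd_fin_algebra_def space_Sup_eq_UN by auto
qed

lemma measurable_emeasure_bdd_fin:
  assumes "A \<in> sets borel"
  shows "(\<lambda>\<mu>. emeasure \<mu> A) \<in> borel_measurable bdd_fin_algebra"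
  unfolding bdd_fin_algebra_def
  by (rule measurable_SUP1[OF assms]) (auto intro: measurable_vimage_algebra1)

lemma measurable_bdd_fin_algebraI:
  assumes "f \<in> space N \<rightarrow> space bdd_fin_algebra"
    and "\<And>A. A \<in> sets borel \<Longrightarrow> (\<lambda>x. emeasure (f x) A) \<in> borel_measurable N"
  shows "f \<in> measurable N bdd_fin_algebra"
  unfolding bdd_fin_algebra_def
  by (rule measurable_SUP2)
     (use assms in \<open>auto intro!: measurable_vimage_algebra2 simp: space_bdd_fin_algebra\<close>)

lemma measurable_nn_integral_bdd_fin:
  fixes f :: "'y::polish_space \<Rightarrow> ennreal"
  assumes "f \<in> borel_measurable borel"
  shows "(\<lambda>\<mu>. \<integral>\<^sup>+y. f y \<partial>\<mu>) \<in> borel_measurable bdd_fin_algebra"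
proof -
  have meas: "u \<in> borel_measurable \<mu>" if "u \<in> borel_measurable borel" "\<mu> \<in> space bdd_fin_algebra"
    for u :: "'y \<Rightarrow> ennreal" and \<mu>
    using that measurable_cong_sets[of \<mu> borel borel borel] by (auto simp: space_bdd_fin_algebra)
  from assms show ?thesis
  proof (induction rule: borel_measurable_induct)
    case (cong f g)
    then have "f = g" by auto
    with cong show ?case by simp
  next
    case (set A)
    have "(\<integral>\<^sup>+y. indicator A y \<partial>\<mu>) = emeasure \<mu> A" if "\<mu> \<in> space bdd_fin_algebra" for \<mu> :: "'y measure"
      using set that by (simp add: space_bdd_fin_algebra)
    then show ?case
      using measurable_emeasure_bdd_fin[OF set] by (subst measurable_cong) auto
  next
    case (mult u c)
    have eq: "(\<integral>\<^sup>+y. c * u y \<partial>\<mu>) = c * (\<integral>\<^sup>+y. u y \<partial>\<mu>)" if "\<mu> \<in> space bdd_fin_algebra" for \<mu>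
      by (rule nn_integral_cmult) (rule meas[OF mult(2) that])
    show ?case using mult by (subst measurable_cong[OF eq]) auto
  next
    case (add u v)
    have eq: "(\<integral>\<^sup>+y. v y + u y \<partial>\<mu>) = (\<integral>\<^sup>+y. v y \<partial>\<mu>) + (\<integral>\<^sup>+y. u y \<partial>\<mu>)" if "\<mu> \<in> space bdd_fin_algebra" for \<mu>
      by (rule nn_integral_add; rule meas) (use add that in auto)
    show ?case using add by (subst measurable_cong[OF eq]) auto
  next
    case (seq U)
    have eq: "(\<integral>\<^sup>+y. (SUP i. U i) y \<partial>\<mu>) = (SUP i. \<integral>\<^sup>+y. U i y \<partial>\<mu>)" if "\<mu> \<in> space bdd_fin_algebra" for \<mu>
      unfolding SUP_apply
    proof (rule nn_integral_monotone_convergence_SUP)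
      show "incseq U" by fact
      show "U i \<in> borel_measurable \<mu>" for i by (rule meas[OF seq(1) that])
    qed
    have "(\<lambda>\<mu>. SUP i. \<integral>\<^sup>+y. U i y \<partial>\<mu>) \<in> borel_measurable bdd_fin_algebra"
      by (rule borel_measurable_SUP) (simp, rule seq)
    then show ?case by (subst measurable_cong[OF eq])
  qed
qed

lemma integral_bdd_fin_algebra:
  fixes g :: "'y::polish_space \<Rightarrow> real"
  assumes "g \<in> borel_measurable borel" and "\<And>y. g y \<ge> 0" and "\<mu> \<in> space bdd_fin_algebra"
  shows "(\<integral>y. g y \<partial>\<mu>) = enn2real (\<integral>\<^sup>+y. ennreal (g y) \<partial>\<mu>)"
proof (rule integral_eq_nn_integral)
  have "sets \<mu> = sets borel" using assms(3) by (simp add: space_bdd_fin_algebra)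
  then show "g \<in> borel_measurable \<mu>" using assms(1) measurable_cong_sets by blast
qed (use assms in auto)

lemma measurable_integral_bdd_fin:
  fixes g :: "'y::polish_space \<Rightarrow> real"
  assumes [measurable]: "g \<in> borel_measurable borel" and "\<And>y. g y \<ge> 0"
  shows "(\<lambda>\<mu>. \<integral>y. g y \<partial>\<mu>) \<in> borel_measurable bdd_fin_algebra"
  by (subst measurable_cong[OF integral_bdd_fin_algebra[OF assms]])
     (auto intro!: borel_measurable_enn2real measurable_nn_integral_bdd_fin)

section \<open>The Laplace functional of the gamma process\<close>

text \<open>
  The continuous extension of \<open>x \<mapsto> exp (- x)\<close> to \<open>[0,\<infinity>]\<close>.  It gives the Laplace functional a meaning
  before \<open>\<mu>(f)\<close> is known to be finite.
\<close>
definition exp_neg :: "ennreal \<Rightarrow> real" where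
  "exp_neg x = (if x = \<infinity> then 0 else exp (- enn2real x))"

lemma exp_neg_ennreal [simp]: "x \<ge> 0 \<Longrightarrow> exp_neg (ennreal x) = exp (- x)"
  by (simp add: exp_neg_def)

lemma exp_neg_0 [simp]: "exp_neg 0 = 1"
  by (simp add: exp_neg_def)

lemma exp_neg_top [simp]: "exp_neg \<top> = 0"
  by (simp add: exp_neg_def)

lemma exp_neg_bounds [simp]: "0 \<le> exp_neg x" "exp_neg x \<le> 1"
  by (auto simp: exp_neg_def)

lemma exp_neg_add: "exp_neg (x + y) = exp_neg x * exp_neg y"
  by (cases x; cases y) (auto simp: exp_add[symmetric] simp flip: ennreal_plus)

lemma exp_neg_sum: "finite I \<Longrightarrow> exp_neg (\<Sum>i\<in>I. f i) = (\<Prod>i\<in>I. exp_neg (f i))"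
  by (induction I rule: finite_induct) (auto simp: exp_neg_add)

lemma borel_measurable_exp_neg [measurable]: "exp_neg \<in> borel_measurable borel"
  unfolding exp_neg_def by measurable

lemma tendsto_exp_neg:
  assumes "(X \<longlongrightarrow> x) F"
  shows "((\<lambda>i. exp_neg (X i)) \<longlongrightarrow> exp_neg x) F"
proof (cases "x = \<top>")
  case True
  have "\<forall>\<^sub>F i in F. \<bar>exp_neg (X i)\<bar> < e" if "e > 0" for e
  proof -
    have "\<forall>\<^sub>F i in F. ennreal (max 0 (- ln e)) < X i"
      using assms by (rule order_tendstoD(1)) (simp add: True)
    then show ?thesis
    proof eventually_elim
      case (elim i)
      show ?case
      proof (cases "X i")
        case (real r)
        then have "- ln e < r" using elim by (cases "- ln e < 0") (auto simp: ennreal_less_iff max_def split: if_splits)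
        then have "exp (- r) < exp (ln e)" by simp
        then show ?thesis using real that by simp
      qed (use that in simp)
    qed
  qed
  then show ?thesis unfolding True by (auto simp: tendsto_iff)
next
  case False
  then have "\<forall>\<^sub>F i in F. X i < \<top>"
    using assms by (intro order_tendstoD(2)) (auto simp: less_top)
  then have ev: "\<forall>\<^sub>F i in F. exp (- enn2real (X i)) = exp_neg (X i)"
    by eventually_elim (auto simp: exp_neg_def)
  have "((\<lambda>i. exp (- enn2real (X i))) \<longlongrightarrow> exp (- enn2real x)) F"
    using assms False by (intro tendsto_intros tendsto_enn2real) (auto simp: less_top)
  then have "((\<lambda>i. exp_neg (X i)) \<longlongrightarrow> exp (- enn2real x)) F"
    by (rule Lim_transform_eventually) (rule ev)
  then show ?thesis using False by (simp add: exp_neg_def)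
qed

locale gamma_process = finite_measure \<alpha> for \<alpha> :: "'y::polish_space measure" +
  fixes G :: "'y measure measure"
  assumes sets_shape [measurable_cong]: "sets \<alpha> = sets borel"
    and gamma_law: "gamma_process_law \<alpha> G"
begin

lemma sets_G [measurable_cong]: "sets G = sets bdd_fin_algebra"
  using gamma_law by (simp add: gamma_process_law_def)

lemma space_G: "\<mu> \<in> space G \<Longrightarrow> sets \<mu> = sets borel"
  using sets_eq_imp_space_eq[OF sets_G] by (auto simp: space_bdd_fin_algebra)

sublocale G: prob_space G
  using gamma_law by (simp add: gamma_process_law_def)

lemma space_shape [simp]: "space \<alpha> = UNIV"
  using sets_eq_imp_space_eq[OF sets_shape] by simp

lemma measurable_nn_integral_G [measurable]:
  "f \<in> borel_measurable borel \<Longrightarrow> (\<lambda>\<mu>. \<integral>\<^sup>+y. f y \<partial>\<mu>) \<in> borel_measurable G"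
  using measurable_nn_integral_bdd_fin[of f] measurable_cong_sets[OF sets_G refl] by blast

lemma measurable_emeasure_G [measurable]:
  "A \<in> sets borel \<Longrightarrow> (\<lambda>\<mu>. emeasure \<mu> A) \<in> borel_measurable G"
  using measurable_emeasure_bdd_fin[of A] measurable_cong_sets[OF sets_G refl] by blast

lemma laplace_emeasure:
  assumes A [measurable]: "A \<in> sets borel" and c: "c \<ge> 0"
  shows "(\<integral>\<mu>. exp_neg (ennreal c * emeasure \<mu> A) \<partial>G) = (1 + c) powr (- measure \<alpha> A)"
proof -
  define a where "a = measure \<alpha> A"
  have law: "distr G borel (\<lambda>\<mu>. emeasure \<mu> A) = distr (gamma_distribution a) borel ennreal"
    using gamma_law A unfolding gamma_process_law_def a_def by blast
  have sets_gd [measurable_cong]: "sets (gamma_distribution a) = sets borel"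
    by (simp add: gamma_distribution_def)
  have "(\<integral>\<mu>. exp_neg (ennreal c * emeasure \<mu> A) \<partial>G) = (\<integral>x. exp_neg (ennreal c * x) \<partial>distr G borel (\<lambda>\<mu>. emeasure \<mu> A))"
    by (rule integral_distr[symmetric]) measurable
  also have "\<dots> = (\<integral>x. exp_neg (ennreal c * ennreal x) \<partial>gamma_distribution a)"
    unfolding law by (rule integral_distr) measurable
  also have "\<dots> = (1 + c) powr (- a)"
  proof (cases "a = 0")
    case True
    then show ?thesis using c by (simp add: gamma_distribution_def integral_return)
  next
    case False
    then have a: "a > 0" using measure_nonneg[of \<alpha> A] unfolding a_def by linarith
    have "(\<integral>x. exp_neg (ennreal c * ennreal x) \<partial>gamma_distribution a) =
        enn2real (\<integral>\<^sup>+x. ennreal (exp_neg (ennreal c * ennreal x)) \<partial>gamma_distribution a)"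
      by (rule integral_eq_nn_integral) auto
    also have "(\<integral>\<^sup>+x. ennreal (exp_neg (ennreal c * ennreal x)) \<partial>gamma_distribution a) =
        (\<integral>\<^sup>+x. ennreal (x powr (a - 1) * exp (- x) / Gamma a * indicator {0<..} x) *
               ennreal (exp_neg (ennreal c * ennreal x)) \<partial>lborel)"
      using False unfolding gamma_distribution_def by (simp add: nn_integral_density)
    also have "\<dots> = (\<integral>\<^sup>+x. ennreal (1 / Gamma a) *
               (ennreal (x powr (a - 1) * exp (- ((1 + c) * x))) * indicator {0<..} x) \<partial>lborel)"
      using c Gamma_real_pos[OF a]
      by (intro nn_integral_cong)
         (auto simp: indicator_def exp_add[symmetric] distrib_right simp flip: ennreal_mult)
    also have "\<dots> = ennreal (1 / Gamma a) * ennreal (Gamma a * (1 + c) powr (- a))"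
      using a c by (subst nn_integral_cmult) (auto simp: nn_integral_Gamma_scaled)
    also have "\<dots> = ennreal ((1 + c) powr (- a))"
      using Gamma_real_pos[OF a] by (subst ennreal_mult[symmetric]) auto
    finally show ?thesis by simp
  qed
  finally show ?thesis by (simp add: a_def)
qed

text \<open>
  The level sets of a simple function are disjoint, so \<open>\<mu>(s)\<close> is a finite sum of independent multiples of
  gamma variables and the transform factorises.
\<close>
lemma laplace_functional_simple:
  fixes s :: "'y \<Rightarrow> ennreal"
  assumes s: "simple_function borel s" "\<And>y. s y < \<top>"
  shows "(\<integral>\<mu>. exp_neg (\<integral>\<^sup>+y. s y \<partial>\<mu>) \<partial>G) = exp (- (\<integral>y. ln (1 + enn2real (s y)) \<partial>\<alpha>))"
proof -
  have fin: "finite (range s)" using simple_functionD(1)[OF s(1)] by simp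
  have level [measurable]: "s -` {x} \<in> sets borel" for x
    using simple_functionD(2)[OF s(1), of "{x}"] by simp
  obtain h where h: "bij_betw h {0..<card (range s)} (range s)"
    using ex_bij_betw_nat_finite[OF fin] by blast
  define m where "m = card (range s)"
  have h: "bij_betw h {..<m} (range s)" using h by (simp add: m_def lessThan_atLeast0)
  define A where "A i = (if i < m then s -` {h i} else {})" for i
  have h_fin: "h i < \<top>" if "i < m" for i
  proof -
    have "h i \<in> range s" using bij_betw_apply[OF h] that by simp
    then show ?thesis using s(2) by auto
  qed
  have A_sets [measurable]: "A i \<in> sets borel" for i by (simp add: A_def)
  have disj: "disjoint_family A"
    using h by (auto simp: disjoint_family_on_def A_def bij_betw_def inj_on_def)
  have indep: "G.indep_vars (\<lambda>_. borel) (\<lambda>i \<mu>. emeasure \<mu> (A i)) UNIV"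
    using gamma_law disj A_sets unfolding gamma_process_law_def by blast
  have split_sum: "exp_neg (\<integral>\<^sup>+y. s y \<partial>\<mu>) = (\<Prod>i<m. exp_neg (h i * emeasure \<mu> (A i)))"
    if "\<mu> \<in> space G" for \<mu>
  proof -
    have sets: "sets \<mu> = sets borel" using space_G[OF that] .
    have sp: "space \<mu> = UNIV" using sets_eq_imp_space_eq[OF sets] by simp
    have "simple_function \<mu> s" using s(1) sets sp by (simp add: simple_function_def)
    then have "(\<integral>\<^sup>+y. s y \<partial>\<mu>) = (\<Sum>x\<in>range s. x * emeasure \<mu> (s -` {x}))"
      by (simp add: nn_integral_eq_simple_integral simple_integral_def sp)
    also have "\<dots> = (\<Sum>i<m. h i * emeasure \<mu> (A i))"
      by (subst sum.reindex_bij_betw[OF h, symmetric]) (simp add: A_def)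
    finally show ?thesis by (simp add: exp_neg_sum)
  qed
  have "(\<integral>\<mu>. exp_neg (\<integral>\<^sup>+y. s y \<partial>\<mu>) \<partial>G) = (\<integral>\<mu>. (\<Prod>i<m. exp_neg (h i * emeasure \<mu> (A i))) \<partial>G)"
    by (rule Bochner_Integration.integral_cong) (simp_all add: split_sum)
  also have "\<dots> = (\<Prod>i<m. \<integral>\<mu>. exp_neg (h i * emeasure \<mu> (A i)) \<partial>G)"
  proof (rule G.indep_vars_lebesgue_integral)
    show "G.indep_vars (\<lambda>_. borel) (\<lambda>i \<mu>. exp_neg (h i * emeasure \<mu> (A i))) {..<m}"
      by (rule G.indep_vars_compose2[OF G.indep_vars_subset[OF indep]]) auto
    show "integrable G (\<lambda>\<mu>. exp_neg (h i * emeasure \<mu> (A i)))" for i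
      by (rule G.integrable_const_bound[where B = 1]) auto
  qed simp
  also have "\<dots> = (\<Prod>i<m. (1 + enn2real (h i)) powr (- measure \<alpha> (A i)))"
  proof (rule prod.cong[OF refl])
    fix i assume "i \<in> {..<m}"
    then have "h i = ennreal (enn2real (h i))" using h_fin by simp
    then show "(\<integral>\<mu>. exp_neg (h i * emeasure \<mu> (A i)) \<partial>G) = (1 + enn2real (h i)) powr (- measure \<alpha> (A i))"
      using laplace_emeasure[OF A_sets, of "enn2real (h i)" i] by simp
  qed
  also have "\<dots> = exp (- (\<Sum>i<m. ln (1 + enn2real (h i)) * measure \<alpha> (A i)))"
  proof -
    have "1 + enn2real x \<noteq> 0" for x using enn2real_nonneg[of x] by linarith
    then show ?thesis
      by (simp add: powr_def exp_sum sum_negf[symmetric] mult.commute)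
  qed
  also have "(\<Sum>i<m. ln (1 + enn2real (h i)) * measure \<alpha> (A i)) =
      (\<Sum>x\<in>range s. ln (1 + enn2real x) * measure \<alpha> (s -` {x}))"
    by (subst sum.reindex_bij_betw[OF h, symmetric]) (simp add: A_def)
  also have "\<dots> = (\<integral>y. (\<Sum>x\<in>range s. ln (1 + enn2real x) * indicator (s -` {x}) y) \<partial>\<alpha>)"
  proof (subst Bochner_Integration.integral_sum)
    have "integrable \<alpha> (indicator (s -` {x}) :: 'y \<Rightarrow> real)" for x
      by (rule integrable_real_indicator) (auto simp: less_top[symmetric])
    then show "integrable \<alpha> (\<lambda>y. ln (1 + enn2real x) * indicator (s -` {x}) y)" for x
      by (rule integrable_mult_right)
  qed simp
  also have "(\<lambda>y. \<Sum>x\<in>range s. ln (1 + enn2real x) * indicator (s -` {x}) y) = (\<lambda>y. ln (1 + enn2real (s y)))"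
  proof
    fix y
    have "(\<Sum>x\<in>range s. ln (1 + enn2real x) * indicator (s -` {x}) y) =
        (\<Sum>x\<in>range s. if x = s y then ln (1 + enn2real x) else 0)"
      by (rule sum.cong) (auto simp: indicator_def)
    then show "(\<Sum>x\<in>range s. ln (1 + enn2real x) * indicator (s -` {x}) y) = ln (1 + enn2real (s y))"
      using fin by simp
  qed
  finally show ?thesis .
qed

lemma laplace_functional_exp_neg:
  fixes f :: "'y \<Rightarrow> real"
  assumes f [measurable]: "f \<in> borel_measurable borel" and f0: "\<And>y. f y \<ge> 0"
    and int: "integrable \<alpha> (\<lambda>y. ln (1 + f y))"
  shows "(\<integral>\<mu>. exp_neg (\<integral>\<^sup>+y. ennreal (f y) \<partial>\<mu>) \<partial>G) = exp (- (\<integral>y. ln (1 + f y) \<partial>\<alpha>))"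
proof -
  obtain s where s: "\<And>i. simple_function borel (s i)" "incseq s" "\<And>i y. s i y < \<top>"
    "\<And>y. (SUP i. s i y) = ennreal (f y)"
    using borel_measurable_implies_simple_function_sequence'[of "\<lambda>y. ennreal (f y)" borel] by auto
  have s_meas [measurable]: "s i \<in> borel_measurable borel" for i
    using s(1) by (rule borel_measurable_simple_function)
  have s_mono: "incseq (\<lambda>i. s i y)" for y using s(2) by (auto simp: incseq_def le_fun_def)
  have s_lim: "(\<lambda>i. s i y) \<longlonglongrightarrow> ennreal (f y)" for y
    using LIMSEQ_SUP[OF s_mono[of y]] by (simp add: s(4))
  have s_le: "enn2real (s i y) \<le> f y" for i y
  proof -
    have "s i y \<le> ennreal (f y)" using s(4)[of y] by (metis SUP_upper UNIV_I)
    then show ?thesis using f0[of y] by (simp add: enn2real_leI)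
  qed
  have sr_lim: "(\<lambda>i. enn2real (s i y)) \<longlonglongrightarrow> f y" for y
    using tendsto_enn2real[OF s_lim[of y]] f0[of y] by simp
  have "(\<lambda>i. \<integral>\<mu>. exp_neg (\<integral>\<^sup>+y. s i y \<partial>\<mu>) \<partial>G) \<longlonglongrightarrow> (\<integral>\<mu>. exp_neg (\<integral>\<^sup>+y. ennreal (f y) \<partial>\<mu>) \<partial>G)"
  proof (rule integral_dominated_convergence[where w = "\<lambda>_. 1"])
    show "AE \<mu> in G. (\<lambda>i. exp_neg (\<integral>\<^sup>+y. s i y \<partial>\<mu>)) \<longlonglongrightarrow> exp_neg (\<integral>\<^sup>+y. ennreal (f y) \<partial>\<mu>)"
    proof (rule AE_I2, rule tendsto_exp_neg)
      fix \<mu> assume "\<mu> \<in> space G"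
      then have [measurable_cong]: "sets \<mu> = sets borel" by (rule space_G)
      have "(\<lambda>i. \<integral>\<^sup>+y. s i y \<partial>\<mu>) \<longlonglongrightarrow> (SUP i. \<integral>\<^sup>+y. s i y \<partial>\<mu>)"
        by (rule LIMSEQ_SUP)
           (auto simp: incseq_def intro!: nn_integral_mono incseqD[OF s_mono])
      also have "(SUP i. \<integral>\<^sup>+y. s i y \<partial>\<mu>) = (\<integral>\<^sup>+y. (SUP i. s i y) \<partial>\<mu>)"
        by (rule nn_integral_monotone_convergence_SUP[symmetric]) (use s(2) in auto)
      finally show "(\<lambda>i. \<integral>\<^sup>+y. s i y \<partial>\<mu>) \<longlonglongrightarrow> (\<integral>\<^sup>+y. ennreal (f y) \<partial>\<mu>)" by (simp add: s(4))
    qed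
  qed auto
  moreover have "(\<lambda>i. \<integral>y. ln (1 + enn2real (s i y)) \<partial>\<alpha>) \<longlonglongrightarrow> (\<integral>y. ln (1 + f y) \<partial>\<alpha>)"
  proof (rule integral_dominated_convergence[where w = "\<lambda>y. ln (1 + f y)"])
    show "AE y in \<alpha>. (\<lambda>i. ln (1 + enn2real (s i y))) \<longlonglongrightarrow> ln (1 + f y)"
    proof (rule AE_I2)
      fix y
      have "1 + f y \<noteq> 0" using f0[of y] by linarith
      then show "(\<lambda>i. ln (1 + enn2real (s i y))) \<longlonglongrightarrow> ln (1 + f y)"
        by (rule tendsto_ln[OF tendsto_add[OF tendsto_const sr_lim]])
    qed
    show "AE y in \<alpha>. norm (ln (1 + enn2real (s i y))) \<le> ln (1 + f y)" for i
    proof (rule AE_I2)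
      fix y show "norm (ln (1 + enn2real (s i y))) \<le> ln (1 + f y)"
        using s_le[of i y] enn2real_nonneg[of "s i y"] by (smt (verit) ln_mono ln_ge_zero real_norm_def)
    qed
    show "integrable \<alpha> (\<lambda>y. ln (1 + f y))" by (rule int)
  qed auto
  then have "(\<lambda>i. exp (- (\<integral>y. ln (1 + enn2real (s i y)) \<partial>\<alpha>))) \<longlonglongrightarrow> exp (- (\<integral>y. ln (1 + f y) \<partial>\<alpha>))"
    by (intro tendsto_intros)
  ultimately show ?thesis
    unfolding laplace_functional_simple[OF s(1,3)] by (rule LIMSEQ_unique)
qed

text \<open>
  As \<open>c \<rightarrow> 0\<close>, \<open>exp_neg (c \<mu>(f))\<close> tends to the indicator of \<open>\<mu>(f) < \<infinity>\<close>, while its expectation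
  \<open>exp (- \<integral> log(1 + c f) d\<alpha>)\<close> tends to \<open>1\<close> by dominated convergence.
\<close>
lemma AE_nn_integral_finite:
  fixes f :: "'y \<Rightarrow> real"
  assumes f [measurable]: "f \<in> borel_measurable borel" and f0: "\<And>y. f y \<ge> 0"
    and int: "integrable \<alpha> (\<lambda>y. ln (1 + f y))"
  shows "AE \<mu> in G. (\<integral>\<^sup>+y. ennreal (f y) \<partial>\<mu>) < \<infinity>"
proof -
  define I where "I \<mu> = (\<integral>\<^sup>+y. ennreal (f y) \<partial>\<mu>)" for \<mu>
  have I_meas [measurable]: "I \<in> borel_measurable G" unfolding I_def by measurable
  \<comment> \<open>Any sequence in \<open>(0, 1]\<close> that tends to \<open>0\<close> would do.\<close>
  define c where "c i = 1 / (real i + 1)" for i :: nat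
  have c: "0 < c i" "c i \<le> 1" for i by (auto simp: c_def)
  have c_lim: "c \<longlonglongrightarrow> 0" unfolding c_def by real_asymp
  have le: "c i * f y \<le> f y" for i y using c(1,2)[of i] f0[of y] by (simp add: mult_left_le_one_le)
  have cf0: "0 \<le> c i * f y" for i y using c(1)[of i] f0[of y] by simp
  have ln_le: "norm (ln (1 + c i * f y)) \<le> ln (1 + f y)" for i y
    using le[of i y] cf0[of i y] by simp
  have scaled: "(\<integral>\<mu>. exp_neg (ennreal (c i) * I \<mu>) \<partial>G) = exp (- (\<integral>y. ln (1 + c i * f y) \<partial>\<alpha>))" for i
  proof -
    have "(\<integral>\<mu>. exp_neg (ennreal (c i) * I \<mu>) \<partial>G) = (\<integral>\<mu>. exp_neg (\<integral>\<^sup>+y. ennreal (c i * f y) \<partial>\<mu>) \<partial>G)"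
    proof (rule Bochner_Integration.integral_cong[OF refl])
      fix \<mu> assume "\<mu> \<in> space G"
      then have [measurable_cong]: "sets \<mu> = sets borel" by (rule space_G)
      show "exp_neg (ennreal (c i) * I \<mu>) = exp_neg (\<integral>\<^sup>+y. ennreal (c i * f y) \<partial>\<mu>)"
        using c(1)[of i] f0 unfolding I_def by (subst nn_integral_cmult[symmetric]) (auto simp: ennreal_mult)
    qed
    also have "\<dots> = exp (- (\<integral>y. ln (1 + c i * f y) \<partial>\<alpha>))"
    proof (rule laplace_functional_exp_neg)
      show "integrable \<alpha> (\<lambda>y. ln (1 + c i * f y))"
        by (rule Bochner_Integration.integrable_bound[OF int])
           (simp, rule AE_I2, rule order_trans[OF ln_le], simp)
    qed (use cf0 in auto)
    finally show ?thesis .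
  qed
  have "(\<lambda>i. \<integral>\<mu>. exp_neg (ennreal (c i) * I \<mu>) \<partial>G) \<longlonglongrightarrow> (\<integral>\<mu>. indicator {\<mu> \<in> space G. I \<mu> < \<top>} \<mu> \<partial>G)"
  proof (rule integral_dominated_convergence[where w = "\<lambda>_. 1"])
    show "AE \<mu> in G. (\<lambda>i. exp_neg (ennreal (c i) * I \<mu>)) \<longlonglongrightarrow> indicator {\<mu> \<in> space G. I \<mu> < \<top>} \<mu>"
    proof (rule AE_I2)
      fix \<mu> assume \<mu>: "\<mu> \<in> space G"
      show "(\<lambda>i. exp_neg (ennreal (c i) * I \<mu>)) \<longlonglongrightarrow> indicator {\<mu> \<in> space G. I \<mu> < \<top>} \<mu>"
      proof (cases "I \<mu>")
        case (real r)
        have "(\<lambda>i. exp (- (c i * r))) \<longlonglongrightarrow> exp (- (0 * r))"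
          by (intro tendsto_intros c_lim)
        moreover have "exp_neg (ennreal (c i) * I \<mu>) = exp (- (c i * r))" for i
          using real c(1)[of i] by (simp flip: ennreal_mult)
        ultimately show ?thesis using real \<mu> by simp
      next
        case top
        have "ennreal (c i) * \<top> = \<top>" for i using c(1)[of i] by (simp add: ennreal_mult_eq_top_iff less_le ennreal_eq_0_iff not_le ennreal_mult_top)
        with top show ?thesis by simp
      qed
    qed
  qed auto
  moreover have "(\<lambda>i. exp (- (\<integral>y. ln (1 + c i * f y) \<partial>\<alpha>))) \<longlonglongrightarrow> exp (- (\<integral>y. 0 \<partial>\<alpha>))"
  proof (intro tendsto_intros integral_dominated_convergence[where w = "\<lambda>y. ln (1 + f y)"])
    show "AE y in \<alpha>. (\<lambda>i. ln (1 + c i * f y)) \<longlonglongrightarrow> 0"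
    proof (rule AE_I2)
      fix y
      have "(\<lambda>i. ln (1 + c i * f y)) \<longlonglongrightarrow> ln (1 + 0 * f y)"
        by (intro tendsto_intros c_lim) simp
      then show "(\<lambda>i. ln (1 + c i * f y)) \<longlonglongrightarrow> 0" by simp
    qed
    show "AE y in \<alpha>. norm (ln (1 + c i * f y)) \<le> ln (1 + f y)" for i
      by (rule AE_I2) (rule ln_le)
  qed (use int in simp_all)
  ultimately have "(\<integral>\<mu>. indicator {\<mu> \<in> space G. I \<mu> < \<top>} \<mu> \<partial>G) = (1 :: real)"
    unfolding scaled by (subst LIMSEQ_unique) auto
  then have "G.prob {\<mu> \<in> space G. I \<mu> < \<top>} = 1" by simp
  then have "AE \<mu> in G. \<mu> \<in> {\<mu> \<in> space G. I \<mu> < \<top>}" by (rule G.AE_prob_1)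
  then show ?thesis by (auto simp: I_def)
qed

lemma integral_eq_enn2real:
  fixes f :: "'y \<Rightarrow> real"
  assumes "f \<in> borel_measurable borel" and "\<And>y. f y \<ge> 0" and "\<mu> \<in> space G"
  shows "(\<integral>y. f y \<partial>\<mu>) = enn2real (\<integral>\<^sup>+y. ennreal (f y) \<partial>\<mu>)"
  using integral_bdd_fin_algebra[OF assms(1,2)] assms(3) sets_eq_imp_space_eq[OF sets_G] by simp

lemma measurable_integral_G:
  fixes f :: "'y \<Rightarrow> real"
  assumes "f \<in> borel_measurable borel" and "\<And>y. f y \<ge> 0"
  shows "(\<lambda>\<mu>. \<integral>y. f y \<partial>\<mu>) \<in> borel_measurable G"
  using measurable_integral_bdd_fin[OF assms] measurable_cong_sets[OF sets_G refl] by blast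

lemma laplace_functional:
  fixes f :: "'y \<Rightarrow> real"
  assumes f [measurable]: "f \<in> borel_measurable borel" and f0: "\<And>y. f y \<ge> 0"
    and int: "integrable \<alpha> (\<lambda>y. ln (1 + f y))"
  shows "(\<integral>\<mu>. exp (- (\<integral>y. f y \<partial>\<mu>)) \<partial>G) = exp (- (\<integral>y. ln (1 + f y) \<partial>\<alpha>))"
proof -
  have "AE \<mu> in G. exp (- (\<integral>y. f y \<partial>\<mu>)) = exp_neg (\<integral>\<^sup>+y. ennreal (f y) \<partial>\<mu>)"
    using AE_nn_integral_finite[OF assms] AE_space
    by eventually_elim (auto simp: integral_eq_enn2real[OF f f0] exp_neg_def)
  then have "(\<integral>\<mu>. exp (- (\<integral>y. f y \<partial>\<mu>)) \<partial>G) = (\<integral>\<mu>. exp_neg (\<integral>\<^sup>+y. ennreal (f y) \<partial>\<mu>) \<partial>G)"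
    using measurable_integral_G[OF f f0] by (intro integral_cong_AE) auto
  then show ?thesis using laplace_functional_exp_neg[OF assms] by simp
qed

lemma AE_total_mass:
  assumes "measure \<alpha> UNIV > 0"
  shows "AE \<mu> in G. 0 < emeasure \<mu> UNIV \<and> emeasure \<mu> UNIV < \<infinity>"
proof -
  define a where "a = measure \<alpha> UNIV"
  have sets_gd [measurable_cong]: "sets (gamma_distribution a) = sets borel"
    by (simp add: gamma_distribution_def)
  have "AE x in gamma_distribution a. 0 < x"
    using assms unfolding gamma_distribution_def a_def
    by (auto simp: AE_density indicator_def)
  then have "AE x in distr (gamma_distribution a) borel ennreal. 0 < x \<and> x < \<infinity>"
    by (subst AE_distr_iff) auto
  also have "distr (gamma_distribution a) borel ennreal = distr G borel (\<lambda>\<mu>. emeasure \<mu> UNIV)"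
    using gamma_law sets.top[of borel] unfolding gamma_process_law_def a_def by simp
  finally show ?thesis by (subst (asm) AE_distr_iff) auto
qed

end

section \<open>Moments of the total mass as sums over partitions\<close>

lemma integrable_ln_affine:
  fixes f :: "'a \<Rightarrow> real"
  assumes M: "finite_measure M" and f [measurable]: "f \<in> borel_measurable M" and f0: "\<And>y. f y \<ge> 0"
    and int: "integrable M (\<lambda>y. ln (1 + f y))" and v: "v \<ge> 1" and t: "t \<ge> 0"
  shows "integrable M (\<lambda>y. ln (v + t * f y))"
proof -
  interpret finite_measure M by fact
  show ?thesis
  proof (rule Bochner_Integration.integrable_bound)
    show "integrable M (\<lambda>y. ln v + ln (1 + t) + ln (1 + f y))"
      using int by (intro Bochner_Integration.integrable_add integrable_const)
    show "AE y in M. norm (ln (v + t * f y)) \<le> norm (ln v + ln (1 + t) + ln (1 + f y))"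
    proof (rule AE_I2)
      fix y
      have tf: "0 \<le> t * f y" using t f0[of y] by simp
      \<comment> \<open>The affine argument is at most \<open>v (1 + t) (1 + f y)\<close>, whose logarithm is integrable.\<close>
      have "v + t * f y \<le> v * (1 + t * f y)"
        using v tf mult_right_mono[of 1 v "t * f y"] by (simp add: distrib_left)
      also have "\<dots> \<le> v * ((1 + t) * (1 + f y))"
        using v t f0[of y] by (intro mult_left_mono) (auto simp: algebra_simps)
      finally have "ln (v + t * f y) \<le> ln (v * ((1 + t) * (1 + f y)))"
        using v tf by (intro ln_mono) auto
      also have "\<dots> = ln v + ln (1 + t) + ln (1 + f y)"
        using v t f0[of y] by (simp add: ln_mult_pos add_pos_nonneg)
      finally have "ln (v + t * f y) \<le> \<dots>" .
      moreover have "0 \<le> ln (v + t * f y)" using v tf by simp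
      ultimately show "norm (ln (v + t * f y)) \<le> norm (ln v + ln (1 + t) + ln (1 + f y))" by simp
    qed
  qed measurable
qed

lemma power_exp_neg_le:
  fixes x s :: real
  assumes "x \<ge> 0" "s > 0"
  shows "x ^ k * exp (- (s * x)) \<le> fact k / s ^ k"
proof -
  have "(\<Sum>i\<in>{k}. (s * x) ^ i /\<^sub>R fact i) \<le> (\<Sum>i. (s * x) ^ i /\<^sub>R fact i)"
    by (rule sum_le_suminf) (use assms summable_exp_generic[of "s * x"] in auto)
  then have "(s * x) ^ k / fact k \<le> exp (s * x)" by (simp add: exp_def field_simps)
  then show ?thesis using assms by (simp add: exp_minus field_simps power_mult_distrib)
qed

text \<open>
  The factor that a cell of size \<open>k\<close> contributes; up to the sign \<open>(- 1)\<^sup>k\<close>, it is the \<open>k\<close>-th derivative in \<open>v\<close> of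
  \<open>- \<integral> log(v + f) dM\<close>.
\<close>
definition cell_moment :: "'a measure \<Rightarrow> ('a \<Rightarrow> real) \<Rightarrow> nat \<Rightarrow> real \<Rightarrow> real" where
  "cell_moment M f k v = Gamma (real k) * (\<integral>y. (v + f y) powr (- real k) \<partial>M)"

text \<open>
  Up to the sign \<open>(- 1)\<^sup>n\<close>, the \<open>n\<close>-th derivative in \<open>v\<close> of \<open>exp (- \<integral> log(v + f) dM)\<close>, in the form given by
  Faa di Bruno's formula.
\<close>
definition partition_moment :: "'a measure \<Rightarrow> ('a \<Rightarrow> real) \<Rightarrow> nat \<Rightarrow> real \<Rightarrow> real" where
  "partition_moment M f n v = exp (- (\<integral>y. ln (v + f y) \<partial>M)) *
     (\<Sum>p \<in> {p. partition_on {1..n} p}. \<Prod>C\<in>p. cell_moment M f (card C) v)"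

lemma partition_on_cell_card:
  fixes n :: nat
  assumes "partition_on {1..n} p" "C \<in> p"
  shows "finite C" "card C > 0"
proof -
  have "C \<subseteq> {1..n}" using partition_onD1[OF assms(1)] assms(2) by blast
  then show "finite C" by (rule finite_subset) simp
  moreover have "C \<noteq> {}" using partition_onD3[OF assms(1)] assms(2) by auto
  ultimately show "card C > 0" by (simp add: card_gt_0_iff)
qed

lemma cell_moment_nonneg: "k > 0 \<Longrightarrow> cell_moment M f k v \<ge> 0"
  unfolding cell_moment_def
  by (intro mult_nonneg_nonneg Bochner_Integration.integral_nonneg) (simp_all add: Gamma_real_pos less_imp_le)

lemma partition_moment_nonneg: "partition_moment M f n v \<ge> 0"
proof -
  have "0 \<le> (\<Prod>C\<in>p. cell_moment M f (card C) v)" if "partition_on {1..n} p" for p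
    by (rule prod_nonneg) (rule cell_moment_nonneg, rule partition_on_cell_card(2)[OF that])
  then show ?thesis
    unfolding partition_moment_def by (intro mult_nonneg_nonneg sum_nonneg) (simp_all only: exp_ge_zero mem_Collect_eq)
qed

lemma (in finite_measure) measurable_partition_moment:
  fixes f :: "real \<Rightarrow> 'a \<Rightarrow> real"
  assumes [measurable]: "case_prod f \<in> borel_measurable (borel \<Otimes>\<^sub>M M)" "h \<in> borel_measurable borel"
  shows "(\<lambda>v. partition_moment M (f v) n (h v)) \<in> borel_measurable borel"
  unfolding partition_moment_def cell_moment_def by measurable

text \<open>
  Each cell \<open>C\<close> is homogeneous of degree \<open>- card C\<close>, and the cell sizes add up to \<open>n\<close>; the exponential
  contributes the total mass of \<open>M\<close>.
\<close>
lemma partition_moment_scale: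
  fixes f :: "'a \<Rightarrow> real"
  assumes "finite_measure M" and [measurable]: "f \<in> borel_measurable M" and f0: "\<And>y. f y \<ge> 0"
    and int: "integrable M (\<lambda>y. ln (1 + f y))" and v: "v \<ge> 1" and c: "c > 0"
  shows "partition_moment M (\<lambda>y. c * f y) n (c * v) =
         c powr (- measure M (space M) - real n) * partition_moment M f n v"
proof -
  interpret finite_measure M by fact
  have pos: "0 < v + f y" for y using v f0[of y] by linarith
  have eq: "c * v + c * f y = c * (v + f y)" for y by (simp add: distrib_left)
  have "(\<integral>y. ln (c * v + c * f y) \<partial>M) = (\<integral>y. ln c + ln (v + f y) \<partial>M)"
    using c pos by (intro Bochner_Integration.integral_cong) (simp_all add: eq ln_mult_pos)
  also have "\<dots> = measure M (space M) * ln c + (\<integral>y. ln (v + f y) \<partial>M)"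
    using integrable_ln_affine[OF finite_measure_axioms _ f0 int v, of 1] by simp
  finally have E: "exp (- (\<integral>y. ln (c * v + c * f y) \<partial>M)) =
      c powr (- measure M (space M)) * exp (- (\<integral>y. ln (v + f y) \<partial>M))"
    using c by (simp add: powr_def exp_add[symmetric])
  have cell: "cell_moment M (\<lambda>y. c * f y) k (c * v) = c powr (- real k) * cell_moment M f k v" for k
  proof -
    have "(\<integral>y. (c * v + c * f y) powr (- real k) \<partial>M) = (\<integral>y. c powr (- real k) * (v + f y) powr (- real k) \<partial>M)"
      using c pos by (intro Bochner_Integration.integral_cong) (simp_all add: eq powr_mult)
    then show ?thesis by (simp add: cell_moment_def)
  qed
  have "(\<Prod>C\<in>p. cell_moment M (\<lambda>y. c * f y) (card C) (c * v)) =
      c powr (- real n) * (\<Prod>C\<in>p. cell_moment M f (card C) v)" if p: "partition_on {1..n} p" for p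
  proof -
    have "(\<Prod>C\<in>p. c powr (- real (card C))) = c powr (\<Sum>C\<in>p. - real (card C))"
      using c by (intro powr_sum[symmetric]) auto
    also have "(\<Sum>C\<in>p. - real (card C)) = - real n"
      using product_partition[OF p] partition_on_cell_card(1)[OF p] by (simp add: sum_negf flip: of_nat_sum)
    finally show ?thesis by (simp add: cell prod.distrib)
  qed
  then have "(\<Sum>p \<in> {p. partition_on {1..n} p}. \<Prod>C\<in>p. cell_moment M (\<lambda>y. c * f y) (card C) (c * v)) =
      c powr (- real n) * (\<Sum>p \<in> {p. partition_on {1..n} p}. \<Prod>C\<in>p. cell_moment M f (card C) v)"
    by (simp add: sum_distrib_left)
  then show ?thesis
    by (simp add: partition_moment_def E powr_diff powr_minus field_simps)
qed

text \<open>
  For \<open>v > 1\<close> the integrand and its derivative are bounded by constants; the factor \<open>k\<close> from the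
  derivative is absorbed by \<open>\<Gamma>(k + 1) = k \<Gamma>(k)\<close>.
\<close>
lemma (in finite_measure) has_real_derivative_cell_moment:
  fixes f :: "'a \<Rightarrow> real"
  assumes [measurable]: "f \<in> borel_measurable M" and f0: "\<And>y. f y \<ge> 0" and v: "v > 1" and k: "k > 0"
  shows "(cell_moment M f k has_real_derivative - cell_moment M f (k + 1) v) (at v)"
proof -
  have le1: "x powr a \<le> 1" if "x > 1" "a \<le> 0" for x a :: real
    using that powr_mono[of a 0 x] by simp
  have gt1: "1 < s + f y" if "s \<in> {1<..}" for s :: real and y using that f0[of y] by simp
  have int: "integrable M (\<lambda>y. (s + f y) powr (- real k))" if "s \<in> {1<..}" for s :: real
    using le1[OF gt1[OF that]] by (intro integrable_const_bound[where B = 1]) auto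
  have "((\<lambda>s. \<integral>y. (s + f y) powr (- real k) \<partial>M) has_real_derivative
        (\<integral>y. - real k * (v + f y) powr (- real (k + 1)) \<partial>M)) (at v)"
  proof (rule has_real_derivative_integral[where S = "{1<..}" and B = "real k"])
    fix s :: real and y assume s: "s \<in> {1<..}"
    have "((\<lambda>s. (s + f y) powr (- real k)) has_real_derivative
        - real k * (s + f y) powr (- real k - 1) * 1) (at s)"
      by (rule DERIV_chain2[OF has_real_derivative_powr])
         (use gt1[OF s, of y] in \<open>auto intro!: derivative_eq_intros\<close>)
    moreover have "- real k - 1 = - real (k + 1)" by simp
    ultimately show "((\<lambda>s. (s + f y) powr (- real k)) has_real_derivative
        - real k * (s + f y) powr (- real (k + 1))) (at s)"
      by (simp only: mult_1_right)
    show "\<bar>- real k * (s + f y) powr (- real (k + 1))\<bar> \<le> real k"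
      using le1[OF gt1[OF s], of "- real (k + 1)" y] by (simp add: abs_mult mult_left_le)
  qed (use int v in auto)
  then have "((\<lambda>s. Gamma (real k) * (\<integral>y. (s + f y) powr (- real k) \<partial>M)) has_real_derivative
        Gamma (real k) * (\<integral>y. - real k * (v + f y) powr (- real (k + 1)) \<partial>M)) (at v)"
    by (rule DERIV_cmult)
  moreover have "Gamma (real k) * (\<integral>y. - real k * (v + f y) powr (- real (k + 1)) \<partial>M) =
      - cell_moment M f (k + 1) v"
  proof -
    have "real k \<notin> \<int>\<^sub>\<le>\<^sub>0" using k by (auto dest: nonpos_Ints_nonpos)
    then have "Gamma (real (k + 1)) = real k * Gamma (real k)"
      using Gamma_plus1[of "real k"] by (simp add: add.commute)
    then show ?thesis by (simp add: cell_moment_def)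
  qed
  ultimately have "((\<lambda>s. Gamma (real k) * (\<integral>y. (s + f y) powr (- real k) \<partial>M)) has_real_derivative
        - cell_moment M f (k + 1) v) (at v)"
    by (simp only:)
  then show ?thesis by (subst cell_moment_def[abs_def])
qed

text \<open>
  The product rule matches the recursion \<open>sum_partitions_insert\<close>: differentiating the exponential opens
  the cell \<open>{n + 1}\<close>, differentiating the factor of \<open>C\<close> adds \<open>n + 1\<close> to \<open>C\<close>.
\<close>
lemma (in finite_measure) has_real_derivative_partition_moment:
  fixes f :: "'a \<Rightarrow> real"
  assumes [measurable]: "f \<in> borel_measurable M" and f0: "\<And>y. f y \<ge> 0"
    and int: "integrable M (\<lambda>y. ln (1 + f y))" and v: "v > 1"
  shows "(partition_moment M f n has_real_derivative - partition_moment M f (Suc n) v) (at v)"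
proof -
  let ?P = "\<lambda>n. {p. partition_on {1..n::nat} p}"
  let ?k = "\<lambda>k. cell_moment M f k v"
  define E where "E s = exp (- (\<integral>y. ln (s + f y) \<partial>M))" for s
  define Z where "Z n s = (\<Sum>p \<in> ?P n. \<Prod>C\<in>p. cell_moment M f (card C) s)" for n s
  have "((\<lambda>s. \<integral>y. ln (s + f y) \<partial>M) has_real_derivative (\<integral>y. 1 / (v + f y) \<partial>M)) (at v)"
  proof (rule has_real_derivative_integral[where S = "{1<..}" and B = 1])
    fix s y assume s: "s \<in> {1::real<..}"
    then have gt1: "1 < s + f y" using f0[of y] by simp
    then show "((\<lambda>s. ln (s + f y)) has_real_derivative 1 / (s + f y)) (at s)"
      by (auto intro!: derivative_eq_intros)
    show "\<bar>1 / (s + f y)\<bar> \<le> 1" using gt1 by simp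
  next
    fix s assume "s \<in> {1::real<..}"
    then show "integrable M (\<lambda>y. ln (s + f y))"
      using integrable_ln_affine[OF finite_measure_axioms _ f0 int, of s 1] by simp
  qed (use v in auto)
  moreover have "(\<integral>y. 1 / (v + f y) \<partial>M) = ?k 1"
  proof -
    have "(v + f y) powr (- real 1) = 1 / (v + f y)" for y
      using v f0[of y] by (simp add: powr_minus_divide)
    then show ?thesis unfolding cell_moment_def by (simp only:) simp
  qed
  ultimately have dE: "(E has_real_derivative - ?k 1 * E v) (at v)"
    unfolding E_def by (auto intro!: derivative_eq_intros)
  have dZ: "(Z n has_real_derivative
      (\<Sum>p \<in> ?P n. \<Sum>C\<in>p. - ?k (card C + 1) * (\<Prod>D\<in>p - {C}. ?k (card D)))) (at v)"
    unfolding Z_def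
    by (intro DERIV_sum has_field_derivative_prod has_real_derivative_cell_moment)
       (use f0 v in \<open>simp_all add: partition_on_cell_card(2) del: One_nat_def\<close>)
  have "{1..Suc n} = insert (Suc n) {1..n}" by (simp add: atLeastAtMostSuc_conv)
  then have "Z (Suc n) v = (\<Sum>p \<in> ?P n. ?k 1 * (\<Prod>C\<in>p. ?k (card C)) +
      (\<Sum>C\<in>p. ?k (card C + 1) * (\<Prod>D\<in>p - {C}. ?k (card D))))"
    unfolding Z_def by (simp only:) (rule sum_partitions_insert, auto)
  also have "\<dots> = ?k 1 * Z n v - (\<Sum>p \<in> ?P n. \<Sum>C\<in>p. - ?k (card C + 1) * (\<Prod>D\<in>p - {C}. ?k (card D)))"
    by (simp add: Z_def sum.distrib sum_distrib_left sum_negf)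
  finally have "E v * Z (Suc n) v = E v * (?k 1 * Z n v -
      (\<Sum>p \<in> ?P n. \<Sum>C\<in>p. - ?k (card C + 1) * (\<Prod>D\<in>p - {C}. ?k (card D))))"
    by (rule arg_cong)
  then have "- (E v * Z (Suc n) v) = - ?k 1 * E v * Z n v +
      (\<Sum>p \<in> ?P n. \<Sum>C\<in>p. - ?k (card C + 1) * (\<Prod>D\<in>p - {C}. ?k (card D))) * E v"
    unfolding right_diff_distrib by (simp only: mult_ac minus_mult_left[symmetric])
  with DERIV_mult[OF dE dZ] show ?thesis
    unfolding partition_moment_def[abs_def] E_def Z_def by simp
qed

text \<open>
  Tonelli's theorem applied to \<open>\<Gamma>(b) X powr (- b) = \<integral> r powr (b - 1) exp(- r X) dr\<close>.  It lowers the exponent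
  of \<open>X\<close> by any \<open>b > 0\<close> at the price of an exponential tilt.
\<close>
lemma (in sigma_finite_measure) nn_integral_powr_mixture:
  fixes X :: "'a \<Rightarrow> real" and W :: "'a \<Rightarrow> ennreal"
  assumes [measurable]: "X \<in> borel_measurable M" "W \<in> borel_measurable M"
    and X: "AE x in M. X x > 0" and b: "b > 0"
  shows "(\<integral>\<^sup>+r. ennreal (r powr (b - 1)) * (\<integral>\<^sup>+x. ennreal (X x powr c * exp (- (r * X x))) * W x \<partial>M)
             * indicator {0<..} r \<partial>lborel) =
         ennreal (Gamma b) * (\<integral>\<^sup>+x. ennreal (X x powr (c - b)) * W x \<partial>M)"
    (is "?L = ?R")
proof -
  interpret pair_sigma_finite M lborel ..
  define F where "F x r = ennreal (r powr (b - 1) * exp (- (X x * r))) * indicator {0<..} r *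
      (ennreal (X x powr c) * W x)" for x r
  have "?L = (\<integral>\<^sup>+r. \<integral>\<^sup>+x. F x r \<partial>M \<partial>lborel)"
  proof (rule nn_integral_cong)
    fix r :: real
    have "(\<integral>\<^sup>+x. F x r \<partial>M) = (\<integral>\<^sup>+x. (ennreal (r powr (b - 1)) * indicator {0<..} r) *
        (ennreal (X x powr c * exp (- (r * X x))) * W x) \<partial>M)"
    proof (rule nn_integral_cong)
      fix x
      have "ennreal (r powr (b - 1) * exp (- (X x * r))) = ennreal (r powr (b - 1)) * ennreal (exp (- (r * X x)))"
        by (simp add: ennreal_mult mult.commute)
      moreover have "ennreal (X x powr c * exp (- (r * X x))) = ennreal (X x powr c) * ennreal (exp (- (r * X x)))"
        by (rule ennreal_mult) simp_all
      ultimately show "F x r = (ennreal (r powr (b - 1)) * indicator {0<..} r) *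
          (ennreal (X x powr c * exp (- (r * X x))) * W x)"
        by (simp only: F_def mult_ac)
    qed
    also have "\<dots> = (ennreal (r powr (b - 1)) * indicator {0<..} r) *
        (\<integral>\<^sup>+x. ennreal (X x powr c * exp (- (r * X x))) * W x \<partial>M)"
      by (rule nn_integral_cmult) simp
    finally show "ennreal (r powr (b - 1)) * (\<integral>\<^sup>+x. ennreal (X x powr c * exp (- (r * X x))) * W x \<partial>M)
        * indicator {0<..} r = (\<integral>\<^sup>+x. F x r \<partial>M)"
      by (simp only: mult_ac)
  qed
  also have "\<dots> = (\<integral>\<^sup>+x. \<integral>\<^sup>+r. F x r \<partial>lborel \<partial>M)"
    unfolding F_def by (rule Fubini') measurable
  also have "\<dots> = (\<integral>\<^sup>+x. ennreal (Gamma b) * (ennreal (X x powr (c - b)) * W x) \<partial>M)"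
  proof (rule nn_integral_cong_AE, use X in eventually_elim)
    fix x assume x: "X x > 0"
    have "(\<integral>\<^sup>+r. F x r \<partial>lborel) = ennreal (Gamma b * X x powr (- b)) * (ennreal (X x powr c) * W x)"
      unfolding F_def using nn_integral_Gamma_scaled[OF b x] by (subst nn_integral_multc) auto
    also have "ennreal (Gamma b * X x powr (- b)) * (ennreal (X x powr c) * W x) =
        ennreal (Gamma b * X x powr (- b) * X x powr c) * W x"
      using b by (subst mult.assoc[symmetric], subst ennreal_mult[symmetric])
        (simp_all add: Gamma_real_pos less_imp_le)
    also have "Gamma b * X x powr (- b) * X x powr c = Gamma b * X x powr (c - b)"
      by (simp add: mult.assoc flip: powr_add)
    also have "ennreal (Gamma b * X x powr (c - b)) * W x = ennreal (Gamma b) * (ennreal (X x powr (c - b)) * W x)"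
      using b by (subst ennreal_mult) (simp_all add: Gamma_real_pos less_imp_le mult.assoc)
    finally show "(\<integral>\<^sup>+r. F x r \<partial>lborel) = ennreal (Gamma b) * (ennreal (X x powr (c - b)) * W x)" .
  qed
  also have "\<dots> = ?R" by (rule nn_integral_cmult) simp
  finally show ?thesis .
qed

context gamma_process
begin

text \<open>
  Induction on \<open>n\<close>: both sides are differentiated at \<open>s\<close>.  Keeping \<open>s > 0\<close> makes \<open>T\<^sup>n exp(- s T)\<close> bounded,
  locally uniformly in \<open>s\<close>, so that no moment of \<open>T\<close> has to be controlled beforehand.
\<close>
lemma total_mass_moment:
  fixes f :: "'y \<Rightarrow> real"
  assumes f [measurable]: "f \<in> borel_measurable borel" and f0: "\<And>y. f y \<ge> 0"
    and int: "integrable \<alpha> (\<lambda>y. ln (1 + f y))" and mass: "measure \<alpha> UNIV > 0" and s: "s > 0"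
  shows "(\<integral>\<mu>. measure \<mu> UNIV ^ n * exp (- (s * measure \<mu> UNIV)) * exp (- (\<integral>y. f y \<partial>\<mu>)) \<partial>G) =
         partition_moment \<alpha> f n (1 + s)"
  using s
proof (induction n arbitrary: s)
  case 0
  have f\<alpha> [measurable]: "f \<in> borel_measurable \<alpha>" using f measurable_cong_sets[OF sets_shape refl] by blast
  have "AE \<mu> in G. exp (- (s * measure \<mu> UNIV)) * exp (- (\<integral>y. f y \<partial>\<mu>)) = exp (- (\<integral>y. s + f y \<partial>\<mu>))"
    using AE_nn_integral_finite[OF f f0 int] AE_total_mass[OF mass] AE_space
  proof eventually_elim
    case (elim \<mu>)
    have sets [measurable_cong]: "sets \<mu> = sets borel" using elim(3) by (rule space_G)
    have sp: "space \<mu> = UNIV" using sets_eq_imp_space_eq[OF sets] by simp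
    interpret \<mu>: finite_measure \<mu> by (rule finite_measureI) (use elim(2) in \<open>auto simp: sp\<close>)
    have "integrable \<mu> f" by (rule integrableI_nonneg) (use elim(1) f0 in auto)
    then have "(\<integral>y. s + f y \<partial>\<mu>) = s * measure \<mu> UNIV + (\<integral>y. f y \<partial>\<mu>)" by (simp add: sp)
    then show ?case by (simp add: exp_add[symmetric])
  qed
  then have "(\<integral>\<mu>. exp (- (s * measure \<mu> UNIV)) * exp (- (\<integral>y. f y \<partial>\<mu>)) \<partial>G) = (\<integral>\<mu>. exp (- (\<integral>y. s + f y \<partial>\<mu>)) \<partial>G)"
    using measurable_integral_G[OF f f0] measurable_integral_G[of "\<lambda>y. s + f y"] f0 \<open>s > 0\<close>
    by (intro integral_cong_AE) (auto simp: measure_def)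
  also have "\<dots> = exp (- (\<integral>y. ln (1 + (s + f y)) \<partial>\<alpha>))"
    using integrable_ln_affine[OF finite_measure_axioms f\<alpha> f0 int, of "1 + s" 1] f0 \<open>s > 0\<close>
    by (intro laplace_functional) (auto simp: add.assoc)
  finally show ?case by (simp add: partition_moment_def partition_on_empty add.assoc)
next
  case (Suc n)
  have f\<alpha> [measurable]: "f \<in> borel_measurable \<alpha>" using f measurable_cong_sets[OF sets_shape refl] by blast
  have Y_meas [measurable]: "(\<lambda>\<mu>. \<integral>y. f y \<partial>\<mu>) \<in> borel_measurable G"
    by (rule measurable_integral_G[OF f f0])
  have X_meas [measurable]: "(\<lambda>\<mu>. measure \<mu> UNIV) \<in> borel_measurable G"
    unfolding measure_def by measurable
  define h where "h k s \<mu> = measure \<mu> UNIV ^ k * exp (- (s * measure \<mu> UNIV)) * exp (- (\<integral>y. f y \<partial>\<mu>))"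
    for k s and \<mu> :: "'y measure"
  have h_bd: "\<bar>h k t \<mu>\<bar> \<le> fact k / r ^ k" if "r > 0" "t \<ge> r" for k t r \<mu>
  proof -
    have "0 \<le> (\<integral>y. f y \<partial>\<mu>)" using f0 by (intro Bochner_Integration.integral_nonneg)
    then have "\<bar>h k t \<mu>\<bar> \<le> measure \<mu> UNIV ^ k * exp (- (t * measure \<mu> UNIV))"
      by (simp add: h_def abs_mult mult_left_le)
    also have "\<dots> \<le> measure \<mu> UNIV ^ k * exp (- (r * measure \<mu> UNIV))"
      using that by (intro mult_left_mono) (auto intro: mult_right_mono)
    also have "\<dots> \<le> fact k / r ^ k"
      using that by (intro power_exp_neg_le) auto
    finally show ?thesis .
  qed
  have h_int: "integrable G (h k t)" if "t > 0" for k t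
    using h_bd[of t t k] that unfolding h_def
    by (intro G.integrable_const_bound[where B = "fact k / t ^ k"]) auto
  have "((\<lambda>s. \<integral>\<mu>. h n s \<mu> \<partial>G) has_real_derivative (\<integral>\<mu>. - h (Suc n) s \<mu> \<partial>G)) (at s)"
  \<comment> \<open>On \<open>t > s / 2\<close> the derivative is bounded by a constant that does not depend on \<open>t\<close>.\<close>
  proof (rule G.has_real_derivative_integral[where S = "{s / 2<..}" and B = "fact (Suc n) / (s / 2) ^ Suc n"])
    fix t \<mu> assume t: "t \<in> {s / 2<..}"
    show "((\<lambda>s. h n s \<mu>) has_real_derivative - h (Suc n) t \<mu>) (at t)"
      unfolding h_def by (auto intro!: derivative_eq_intros simp: algebra_simps)
    show "\<bar>- h (Suc n) t \<mu>\<bar> \<le> fact (Suc n) / (s / 2) ^ Suc n"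
      unfolding abs_minus_cancel by (rule h_bd) (use t \<open>s > 0\<close> in auto)
  qed (use h_int \<open>s > 0\<close> in auto)
  then have "((\<lambda>s. partition_moment \<alpha> f n (1 + s)) has_real_derivative (\<integral>\<mu>. - h (Suc n) s \<mu> \<partial>G)) (at s)"
  proof (rule has_field_derivative_transform_within_open[where S = "{0<..}"])
    show "(\<integral>\<mu>. h n t \<mu> \<partial>G) = partition_moment \<alpha> f n (1 + t)" if "t \<in> {0<..}" for t
      using Suc.IH[of t] that by (simp add: h_def)
  qed (use \<open>s > 0\<close> in auto)
  moreover have "((\<lambda>s. partition_moment \<alpha> f n (1 + s)) has_real_derivative
      - partition_moment \<alpha> f (Suc n) (1 + s) * 1) (at s)"
    by (rule DERIV_chain2[OF has_real_derivative_partition_moment])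
       (use f0 int \<open>s > 0\<close> in \<open>auto intro!: derivative_eq_intros\<close>)
  ultimately have "(\<integral>\<mu>. - h (Suc n) s \<mu> \<partial>G) = - partition_moment \<alpha> f (Suc n) (1 + s) * 1"
    by (rule DERIV_unique)
  then show ?case by (simp add: h_def)
qed

end

section \<open>Negative powers of the total mass and the two main identities\<close>

context gamma_process
begin

lemma measurable_total_mass [measurable]: "(\<lambda>\<mu>. measure \<mu> UNIV) \<in> borel_measurable G"
  unfolding measure_def by measurable

lemma AE_measure_pos:
  assumes "measure \<alpha> UNIV > 0"
  shows "AE \<mu> in G. 0 < measure \<mu> UNIV"
  using AE_total_mass[OF assms] by eventually_elim (auto simp: measure_def enn2real_positive_iff)

context
  fixes f :: "'y \<Rightarrow> real"
  assumes f [measurable]: "f \<in> borel_measurable borel" and f0: "\<And>y. f y \<ge> 0"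
    and int: "integrable \<alpha> (\<lambda>y. ln (1 + f y))" and mass: "measure \<alpha> UNIV > 0"
begin

lemma f_shape: "f \<in> borel_measurable \<alpha>"
  using f measurable_cong_sets[OF sets_shape refl] by blast

lemma f_integral: "(\<lambda>\<mu>. \<integral>y. f y \<partial>\<mu>) \<in> borel_measurable G"
  by (rule measurable_integral_G[OF f f0])

lemma f_integral_nonneg: "0 \<le> (\<integral>y. f y \<partial>\<mu>)"
  using f0 by (intro Bochner_Integration.integral_nonneg)

lemma measurable_partition_moment_shape:
  fixes a h :: "real \<Rightarrow> real"
  assumes [measurable]: "a \<in> borel_measurable borel" "h \<in> borel_measurable borel"
  shows "(\<lambda>v. partition_moment \<alpha> (\<lambda>y. a v * f y) n (h v)) \<in> borel_measurable borel"
  by (rule measurable_partition_moment[where f = "\<lambda>v y. a v * f y"]) (use f_shape in measurable)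

lemma nn_total_mass_moment:
  assumes s: "s > 0" and t: "t \<ge> 0"
  shows "(\<integral>\<^sup>+\<mu>. ennreal (measure \<mu> UNIV powr real n * exp (- (s * measure \<mu> UNIV))) *
            ennreal (exp (- (t * (\<integral>y. f y \<partial>\<mu>)))) \<partial>G) =
         ennreal (partition_moment \<alpha> (\<lambda>y. t * f y) n (1 + s))"
proof -
  note [measurable] = f_shape f_integral measurable_partition_moment_shape and [simp] = f_integral_nonneg
  have tf: "(\<lambda>y. t * f y) \<in> borel_measurable borel" "\<And>y. t * f y \<ge> 0"
    "integrable \<alpha> (\<lambda>y. ln (1 + t * f y))"
    using f0 t integrable_ln_affine[OF finite_measure_axioms f_shape f0 int, of 1 t] by auto
  define h where "h \<mu> = measure \<mu> UNIV ^ n * exp (- (s * measure \<mu> UNIV)) * exp (- (\<integral>y. t * f y \<partial>\<mu>))" for \<mu>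
  have bd: "\<bar>h \<mu>\<bar> \<le> fact n / s ^ n" for \<mu>
  proof -
    have "\<bar>h \<mu>\<bar> \<le> measure \<mu> UNIV ^ n * exp (- (s * measure \<mu> UNIV))"
      using t by (simp add: h_def abs_mult mult_left_le)
    also have "\<dots> \<le> fact n / s ^ n" using s by (intro power_exp_neg_le) auto
    finally show ?thesis .
  qed
  have h_int: "integrable G h"
    using bd unfolding h_def by (intro G.integrable_const_bound[where B = "fact n / s ^ n"]) auto
  have "(\<integral>\<^sup>+\<mu>. ennreal (measure \<mu> UNIV powr real n * exp (- (s * measure \<mu> UNIV))) *
            ennreal (exp (- (t * (\<integral>y. f y \<partial>\<mu>)))) \<partial>G) = (\<integral>\<^sup>+\<mu>. ennreal (h \<mu>) \<partial>G)"
    by (rule nn_integral_cong_AE, use AE_measure_pos[OF mass] in eventually_elim)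
       (simp add: h_def powr_realpow flip: ennreal_mult)
  also have "\<dots> = ennreal (\<integral>\<mu>. h \<mu> \<partial>G)"
    by (rule nn_integral_eq_integral[OF h_int]) (simp add: h_def)
  also have "(\<integral>\<mu>. h \<mu> \<partial>G) = partition_moment \<alpha> (\<lambda>y. t * f y) n (1 + s)"
    unfolding h_def by (rule total_mass_moment[OF tf mass s])
  finally show ?thesis .
qed

lemma partition_moment_shape_scale:
  assumes "v \<ge> 1" "c > 0"
  shows "partition_moment \<alpha> (\<lambda>y. c * f y) n (c * v) =
         c powr (- measure \<alpha> UNIV - real n) * partition_moment \<alpha> f n v"
  using partition_moment_scale[OF finite_measure_axioms f_shape f0 int assms] by simp

text \<open>
  With \<open>n > q\<close>, both sides are mixtures over \<open>r > 0\<close> of \<open>n\<close>-th moments, to which homogeneity applies after the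
  substitution \<open>r \<mapsto> t r\<close>.  On both sides the rate of the exponential tilt stays positive, which is all
  that the moment formula asks for.
\<close>
lemma tilted_scaling:
  assumes t: "t > 0" and q: "q > 0"
  shows "(\<integral>\<^sup>+\<mu>. ennreal (measure \<mu> UNIV powr q * exp (- (t * measure \<mu> UNIV))) *
            ennreal (exp (- (t * (\<integral>y. f y \<partial>\<mu>)))) \<partial>G) =
         ennreal (t powr (- measure \<alpha> UNIV - q)) *
         (\<integral>\<^sup>+\<mu>. ennreal (measure \<mu> UNIV powr q * exp (- (1 / t * measure \<mu> UNIV))) *
            ennreal (exp (- (\<integral>y. f y \<partial>\<mu>))) \<partial>G)"
    (is "?L = _ * ?R")
proof -
  note [measurable] = f_shape f_integral measurable_partition_moment_shape and [simp] = f_integral_nonneg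
  define \<theta> where "\<theta> = measure \<alpha> UNIV"
  obtain n :: nat where n: "q < real n" using reals_Archimedean2 by blast
  define b where "b = real n - q"
  have b: "b > 0" using n by (simp add: b_def)
  \<comment> \<open>Needed at rates \<open>s = t\<close> and \<open>s = 1 / t\<close>, with the integral of \<open>f\<close> scaled by \<open>t\<close> and \<open>1\<close>.\<close>
  have mixture: "ennreal (Gamma b) * (\<integral>\<^sup>+\<mu>. ennreal (measure \<mu> UNIV powr q * exp (- (s * measure \<mu> UNIV))) *
            ennreal (exp (- (c * (\<integral>y. f y \<partial>\<mu>)))) \<partial>G) =
      (\<integral>\<^sup>+r. ennreal (r powr (b - 1) * partition_moment \<alpha> (\<lambda>y. c * f y) n (1 + r + s)) * indicator {0<..} r \<partial>lborel)"
    if s: "s > 0" and c: "c > 0" for s c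
  proof -
    define W where "W \<mu> = ennreal (exp (- (s * measure \<mu> UNIV))) * ennreal (exp (- (c * (\<integral>y. f y \<partial>\<mu>))))"
      for \<mu> :: "'y measure"
    have [measurable]: "W \<in> borel_measurable G" unfolding W_def by measurable
    have "(\<integral>\<^sup>+r. ennreal (r powr (b - 1)) *
          (\<integral>\<^sup>+\<mu>. ennreal (measure \<mu> UNIV powr real n * exp (- (r * measure \<mu> UNIV))) * W \<mu> \<partial>G)
             * indicator {0<..} r \<partial>lborel) =
        ennreal (Gamma b) * (\<integral>\<^sup>+\<mu>. ennreal (measure \<mu> UNIV powr (real n - b)) * W \<mu> \<partial>G)"
      by (rule G.nn_integral_powr_mixture) (use AE_measure_pos[OF mass] b in auto)
    moreover have "(\<integral>\<^sup>+\<mu>. ennreal (measure \<mu> UNIV powr (real n - b)) * W \<mu> \<partial>G) =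
        (\<integral>\<^sup>+\<mu>. ennreal (measure \<mu> UNIV powr q * exp (- (s * measure \<mu> UNIV))) *
            ennreal (exp (- (c * (\<integral>y. f y \<partial>\<mu>)))) \<partial>G)"
      by (intro nn_integral_cong) (simp add: W_def b_def flip: ennreal_mult mult.assoc)
    moreover have "(\<integral>\<^sup>+\<mu>. ennreal (measure \<mu> UNIV powr real n * exp (- (r * measure \<mu> UNIV))) * W \<mu> \<partial>G) =
        ennreal (partition_moment \<alpha> (\<lambda>y. c * f y) n (1 + r + s))" if "r > 0" for r
    proof -
      have "(\<integral>\<^sup>+\<mu>. ennreal (measure \<mu> UNIV powr real n * exp (- (r * measure \<mu> UNIV))) * W \<mu> \<partial>G) =
          (\<integral>\<^sup>+\<mu>. ennreal (measure \<mu> UNIV powr real n * exp (- ((r + s) * measure \<mu> UNIV))) *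
            ennreal (exp (- (c * (\<integral>y. f y \<partial>\<mu>)))) \<partial>G)"
      proof (rule nn_integral_cong)
        fix \<mu> :: "'y measure"
        have "exp (- ((r + s) * measure \<mu> UNIV)) = exp (- (r * measure \<mu> UNIV)) * exp (- (s * measure \<mu> UNIV))"
          by (simp add: distrib_right flip: exp_add)
        then show "ennreal (measure \<mu> UNIV powr real n * exp (- (r * measure \<mu> UNIV))) * W \<mu> =
            ennreal (measure \<mu> UNIV powr real n * exp (- ((r + s) * measure \<mu> UNIV))) *
            ennreal (exp (- (c * (\<integral>y. f y \<partial>\<mu>))))"
          by (simp add: W_def mult.assoc flip: ennreal_mult)
      qed
      also have "\<dots> = ennreal (partition_moment \<alpha> (\<lambda>y. c * f y) n (1 + (r + s)))"
        using that s c by (intro nn_total_mass_moment) auto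
      finally show ?thesis by (simp add: add.assoc)
    qed
    then have "(\<integral>\<^sup>+r. ennreal (r powr (b - 1)) *
          (\<integral>\<^sup>+\<mu>. ennreal (measure \<mu> UNIV powr real n * exp (- (r * measure \<mu> UNIV))) * W \<mu> \<partial>G)
             * indicator {0<..} r \<partial>lborel) =
        (\<integral>\<^sup>+r. ennreal (r powr (b - 1) * partition_moment \<alpha> (\<lambda>y. c * f y) n (1 + r + s)) * indicator {0<..} r \<partial>lborel)"
      by (intro nn_integral_cong) (simp add: indicator_def ennreal_mult partition_moment_nonneg)
    ultimately show ?thesis by simp
  qed
  have "ennreal (Gamma b) * ?L =
      (\<integral>\<^sup>+r. ennreal (r powr (b - 1) * partition_moment \<alpha> (\<lambda>y. t * f y) n (1 + r + t)) * indicator {0<..} r \<partial>lborel)"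
    by (rule mixture[OF t t])
  also have "\<dots> = ennreal \<bar>t\<bar> * (\<integral>\<^sup>+r. ennreal ((0 + t * r) powr (b - 1) *
      partition_moment \<alpha> (\<lambda>y. t * f y) n (1 + (0 + t * r) + t)) * indicator {0<..} (0 + t * r) \<partial>lborel)"
    using t by (intro nn_integral_real_affine) auto
  also have "\<dots> = (\<integral>\<^sup>+r. ennreal t * (ennreal ((0 + t * r) powr (b - 1) *
      partition_moment \<alpha> (\<lambda>y. t * f y) n (1 + (0 + t * r) + t)) * indicator {0<..} (0 + t * r)) \<partial>lborel)"
    using t by (subst nn_integral_cmult) auto
  also have "\<dots> = (\<integral>\<^sup>+r. ennreal (t powr (- \<theta> - q)) *
      (ennreal (r powr (b - 1) * partition_moment \<alpha> (\<lambda>y. 1 * f y) n (1 + r + 1 / t)) * indicator {0<..} r) \<partial>lborel)"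
  proof (rule nn_integral_cong)
    fix r :: real
    show "ennreal t * (ennreal ((0 + t * r) powr (b - 1) *
        partition_moment \<alpha> (\<lambda>y. t * f y) n (1 + (0 + t * r) + t)) * indicator {0<..} (0 + t * r)) =
      ennreal (t powr (- \<theta> - q)) *
      (ennreal (r powr (b - 1) * partition_moment \<alpha> (\<lambda>y. 1 * f y) n (1 + r + 1 / t)) * indicator {0<..} r)"
    proof (cases "r > 0")
      case False
      then show ?thesis using t by (simp add: indicator_def zero_less_mult_iff)
    next
      case True
      have "1 + (0 + t * r) + t = t * (1 + r + 1 / t)" using t by (simp add: field_simps)
      then have Q: "partition_moment \<alpha> (\<lambda>y. t * f y) n (1 + (0 + t * r) + t) =
          t powr (- \<theta> - real n) * partition_moment \<alpha> f n (1 + r + 1 / t)"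
        using True t by (simp add: partition_moment_shape_scale \<theta>_def)
      have pr: "t * (0 + t * r) powr (b - 1) = t powr b * r powr (b - 1)"
        using True t by (simp add: powr_mult powr_diff)
      have pt: "t powr b * t powr (- \<theta> - real n) = t powr (- \<theta> - q)"
        by (simp add: b_def algebra_simps flip: powr_add)
      have "t * ((0 + t * r) powr (b - 1) * partition_moment \<alpha> (\<lambda>y. t * f y) n (1 + (0 + t * r) + t)) =
          (t powr b * r powr (b - 1)) * (t powr (- \<theta> - real n) * partition_moment \<alpha> f n (1 + r + 1 / t))"
        by (simp only: mult.assoc[symmetric] pr Q)
      also have "\<dots> = (t powr b * t powr (- \<theta> - real n)) * (r powr (b - 1) * partition_moment \<alpha> f n (1 + r + 1 / t))"
        by (simp only: mult_ac)
      finally have "t * ((0 + t * r) powr (b - 1) * partition_moment \<alpha> (\<lambda>y. t * f y) n (1 + (0 + t * r) + t)) =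
          t powr (- \<theta> - q) * (r powr (b - 1) * partition_moment \<alpha> (\<lambda>y. 1 * f y) n (1 + r + 1 / t))"
        by (simp only: pt mult_1)
      then show ?thesis
        using True t by (simp add: partition_moment_nonneg flip: ennreal_mult)
    qed
  qed
  also have "\<dots> = ennreal (t powr (- \<theta> - q)) *
      (\<integral>\<^sup>+r. ennreal (r powr (b - 1) * partition_moment \<alpha> (\<lambda>y. 1 * f y) n (1 + r + 1 / t)) * indicator {0<..} r \<partial>lborel)"
    by (rule nn_integral_cmult) measurable
  also have "\<dots> = ennreal (t powr (- \<theta> - q)) * (ennreal (Gamma b) * ?R)"
    using mixture[of "1 / t" 1] t by simp
  finally have "ennreal (Gamma b) * ?L = ennreal (Gamma b) * (ennreal (t powr (- \<theta> - q)) * ?R)"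
    by (simp add: mult_ac)
  then show ?thesis
    using Gamma_real_pos[OF b] by (simp add: ennreal_mult_cancel_left \<theta>_def)
qed

text \<open>
  The ratio is \<open>(1 + \<mu>(f) / T) powr (- q) = T powr q * (T + \<mu>(f)) powr (- q)\<close>.  Writing the second factor as a
  mixture over \<open>t\<close> leaves the expectations treated in \<open>tilted_scaling\<close>; the inversion \<open>r = 1/t\<close> then makes
  the powers of \<open>t\<close> match a mixture for \<open>T powr (q - \<theta>)\<close>.
\<close>
lemma nn_ratio_identity:
  assumes q: "q > 0"
  shows "ennreal (Gamma q) *
           (\<integral>\<^sup>+\<mu>. ennreal ((1 + (\<integral>y. f y \<partial>\<mu>) / measure \<mu> UNIV) powr (- q)) \<partial>G) =
         ennreal (Gamma (measure \<alpha> UNIV)) *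
           (\<integral>\<^sup>+\<mu>. ennreal (measure \<mu> UNIV powr (q - measure \<alpha> UNIV)) * ennreal (exp (- (\<integral>y. f y \<partial>\<mu>))) \<partial>G)"
proof -
  note [measurable] = f_shape f_integral measurable_partition_moment_shape and [simp] = f_integral_nonneg
  define \<theta> where "\<theta> = measure \<alpha> UNIV"
  have \<theta>: "\<theta> > 0" using mass by (simp add: \<theta>_def)
  define \<Phi> where "\<Phi> r = (\<integral>\<^sup>+\<mu>. ennreal (measure \<mu> UNIV powr q * exp (- (r * measure \<mu> UNIV))) *
            ennreal (exp (- (\<integral>y. f y \<partial>\<mu>))) \<partial>G)" for r
  have \<Phi>_meas [measurable]: "\<Phi> \<in> borel_measurable borel"
    unfolding \<Phi>_def by measurable
  let ?S = "\<lambda>\<mu>. measure \<mu> UNIV + (\<integral>y. f y \<partial>\<mu>)"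
  have S_pos: "AE \<mu> in G. ?S \<mu> > 0"
    using AE_measure_pos[OF mass] by eventually_elim (simp add: add_pos_nonneg)
  have "ennreal (Gamma q) * (\<integral>\<^sup>+\<mu>. ennreal ((1 + (\<integral>y. f y \<partial>\<mu>) / measure \<mu> UNIV) powr (- q)) \<partial>G) =
        ennreal (Gamma q) * (\<integral>\<^sup>+\<mu>. ennreal (?S \<mu> powr (0 - q)) * ennreal (measure \<mu> UNIV powr q) \<partial>G)"
  proof (rule arg_cong[where f = "(*) (ennreal (Gamma q))"], rule nn_integral_cong_AE,
      use AE_measure_pos[OF mass] in eventually_elim)
    fix \<mu> :: "'y measure" assume X: "measure \<mu> UNIV > 0"
    then have "1 + (\<integral>y. f y \<partial>\<mu>) / measure \<mu> UNIV = ?S \<mu> / measure \<mu> UNIV" by (simp add: field_simps)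
    then have "(1 + (\<integral>y. f y \<partial>\<mu>) / measure \<mu> UNIV) powr (- q) = ?S \<mu> powr (0 - q) * measure \<mu> UNIV powr q"
      using X by (simp add: powr_divide powr_minus field_simps)
    then show "ennreal ((1 + (\<integral>y. f y \<partial>\<mu>) / measure \<mu> UNIV) powr (- q)) =
        ennreal (?S \<mu> powr (0 - q)) * ennreal (measure \<mu> UNIV powr q)"
      by (simp add: ennreal_mult)
  qed
  also have "\<dots> = (\<integral>\<^sup>+t. ennreal (t powr (q - 1)) *
      (\<integral>\<^sup>+\<mu>. ennreal (?S \<mu> powr 0 * exp (- (t * ?S \<mu>))) * ennreal (measure \<mu> UNIV powr q) \<partial>G) * indicator {0<..} t \<partial>lborel)"
    by (rule G.nn_integral_powr_mixture[symmetric]) (use S_pos q in auto)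
  also have "\<dots> = (\<integral>\<^sup>+t. ennreal ((1 / t) powr (\<theta> - 1)) * \<Phi> (1 / t) * ennreal (1 / t\<^sup>2) * indicator {0<..} t \<partial>lborel)"
  proof (rule nn_integral_cong)
    fix t :: real
    show "ennreal (t powr (q - 1)) *
        (\<integral>\<^sup>+\<mu>. ennreal (?S \<mu> powr 0 * exp (- (t * ?S \<mu>))) * ennreal (measure \<mu> UNIV powr q) \<partial>G) * indicator {0<..} t =
      ennreal ((1 / t) powr (\<theta> - 1)) * \<Phi> (1 / t) * ennreal (1 / t\<^sup>2) * indicator {0<..} t"
    proof (cases "t > 0")
      case True
      have "(\<integral>\<^sup>+\<mu>. ennreal (?S \<mu> powr 0 * exp (- (t * ?S \<mu>))) * ennreal (measure \<mu> UNIV powr q) \<partial>G) =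
          (\<integral>\<^sup>+\<mu>. ennreal (measure \<mu> UNIV powr q * exp (- (t * measure \<mu> UNIV))) *
            ennreal (exp (- (t * (\<integral>y. f y \<partial>\<mu>)))) \<partial>G)"
      proof (rule nn_integral_cong_AE, use S_pos in eventually_elim)
        fix \<mu> :: "'y measure" assume "?S \<mu> > 0"
        then have "?S \<mu> powr 0 * exp (- (t * ?S \<mu>)) * measure \<mu> UNIV powr q =
            measure \<mu> UNIV powr q * exp (- (t * measure \<mu> UNIV)) * exp (- (t * (\<integral>y. f y \<partial>\<mu>)))"
          by (simp add: distrib_left exp_add exp_diff exp_minus field_simps)
        then show "ennreal (?S \<mu> powr 0 * exp (- (t * ?S \<mu>))) * ennreal (measure \<mu> UNIV powr q) =
            ennreal (measure \<mu> UNIV powr q * exp (- (t * measure \<mu> UNIV))) * ennreal (exp (- (t * (\<integral>y. f y \<partial>\<mu>))))"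
          by (subst (1 2) ennreal_mult[symmetric]) simp_all
      qed
      also have "\<dots> = ennreal (t powr (- \<theta> - q)) * \<Phi> (1 / t)"
        unfolding \<Phi>_def \<theta>_def by (rule tilted_scaling[OF True q])
      finally have E: "(\<integral>\<^sup>+\<mu>. ennreal (?S \<mu> powr 0 * exp (- (t * ?S \<mu>))) * ennreal (measure \<mu> UNIV powr q) \<partial>G) = \<dots>" .
      have "t powr (q - 1) * t powr (- \<theta> - q) = (1 / t) powr (\<theta> - 1) * (1 / t\<^sup>2)"
      proof -
        have "(1 / t) powr (\<theta> - 1) = t powr (1 - \<theta>)"
          using True powr_minus_divide[of t "\<theta> - 1"] by (simp add: powr_divide)
        moreover have "1 / t\<^sup>2 = t powr (- 2)" using True by (simp add: powr_minus powr_numeral inverse_eq_divide)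
        ultimately show ?thesis by (simp flip: powr_add)
      qed
      then have "ennreal (t powr (q - 1)) * ennreal (t powr (- \<theta> - q)) =
          ennreal ((1 / t) powr (\<theta> - 1)) * ennreal (1 / t\<^sup>2)"
        by (simp flip: ennreal_mult)
      then have "ennreal (t powr (q - 1)) * (ennreal (t powr (- \<theta> - q)) * \<Phi> (1 / t)) =
          ennreal ((1 / t) powr (\<theta> - 1)) * \<Phi> (1 / t) * ennreal (1 / t\<^sup>2)"
        by (simp only: mult.assoc[symmetric]) (simp only: mult_ac)
      then show ?thesis by (simp only: E)
    qed simp
  qed
  also have "\<dots> = (\<integral>\<^sup>+r. ennreal (r powr (\<theta> - 1)) * \<Phi> r * indicator {0<..} r \<partial>lborel)"
    by (rule nn_integral_inversion[symmetric]) measurable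
  also have "\<dots> = ennreal (Gamma \<theta>) *
      (\<integral>\<^sup>+\<mu>. ennreal (measure \<mu> UNIV powr (q - \<theta>)) * ennreal (exp (- (\<integral>y. f y \<partial>\<mu>))) \<partial>G)"
    unfolding \<Phi>_def by (rule G.nn_integral_powr_mixture) (use AE_measure_pos[OF mass] \<theta> in auto)
  finally show ?thesis by (simp add: \<theta>_def)
qed

text \<open>
  The exponent \<open>q - \<theta>\<close> is \<open>n - b\<close> with \<open>b = \<theta> + n - q\<close>.  In the mixture over \<open>r\<close> the \<open>n\<close>-th moment at
  \<open>v = 1 + r\<close> appears; with \<open>u = 1 / v\<close>, homogeneity replaces \<open>(v, f)\<close> by \<open>(1, u f)\<close>, and the powers of \<open>u\<close>
  and \<open>1 - u\<close> combine into the beta density.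
\<close>
lemma nn_partition_identity:
  assumes q: "q > 0" and b: "measure \<alpha> UNIV + real n - q > 0"
  shows "ennreal (Gamma (measure \<alpha> UNIV + real n)) *
           (\<integral>\<^sup>+\<mu>. ennreal (measure \<mu> UNIV powr (q - measure \<alpha> UNIV)) * ennreal (exp (- (\<integral>y. f y \<partial>\<mu>))) \<partial>G) =
         ennreal (Gamma q) *
           (\<integral>\<^sup>+u. ennreal (partition_moment \<alpha> (\<lambda>y. u * f y) n 1) \<partial>beta_distribution q (measure \<alpha> UNIV + real n - q))"
    (is "_ * ?R = _")
proof -
  note [measurable] = f_shape f_integral measurable_partition_moment_shape and [simp] = f_integral_nonneg
  define \<theta> where "\<theta> = measure \<alpha> UNIV"
  define b where "b = \<theta> + real n - q"
  have b0: "b > 0" using assms(2) by (simp add: b_def \<theta>_def)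
  have sum: "q + b = \<theta> + real n" by (simp add: b_def)
  have \<theta>n: "\<theta> + real n > 0" using mass by (simp add: \<theta>_def add_pos_nonneg)
  \<comment> \<open>The mixture integrand in terms of \<open>v = 1 + r\<close>, cut off at \<open>v > 1\<close> so that \<open>u = 1 / v\<close> ends up in \<open>(0, 1)\<close>.\<close>
  define F where "F v = ennreal ((v - 1) powr (b - 1) * partition_moment \<alpha> (\<lambda>y. 1 * f y) n v) * indicator {1<..} v"
    for v :: real
  have F_meas [measurable]: "F \<in> borel_measurable borel"
    unfolding F_def by measurable
  have "ennreal (Gamma b) * ?R = (\<integral>\<^sup>+r. ennreal (r powr (b - 1)) *
      (\<integral>\<^sup>+\<mu>. ennreal (measure \<mu> UNIV powr real n * exp (- (r * measure \<mu> UNIV))) *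
        ennreal (exp (- (\<integral>y. f y \<partial>\<mu>))) \<partial>G) * indicator {0<..} r \<partial>lborel)"
  proof -
    have "q - measure \<alpha> UNIV = real n - b" by (simp add: b_def \<theta>_def)
    then show ?thesis
      by (simp only:) (rule G.nn_integral_powr_mixture[symmetric], use AE_measure_pos[OF mass] b0 in auto)
  qed
  also have "\<dots> = (\<integral>\<^sup>+r. F (1 + 1 * r) \<partial>lborel)"
    using nn_total_mass_moment[of _ 1 n]
    by (intro nn_integral_cong) (auto simp: F_def indicator_def ennreal_mult partition_moment_nonneg)
  also have "\<dots> = (\<integral>\<^sup>+v. F v \<partial>lborel)"
    by (subst nn_integral_real_affine[of F 1 1, OF F_meas]) simp_all
  also have "\<dots> = (\<integral>\<^sup>+v. F v * indicator {0<..} v \<partial>lborel)"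
    by (intro nn_integral_cong) (auto simp: F_def indicator_def)
  also have "\<dots> = (\<integral>\<^sup>+u. F (1 / u) * ennreal (1 / u\<^sup>2) * indicator {0<..} u \<partial>lborel)"
    by (rule nn_integral_inversion) measurable
  also have "\<dots> = (\<integral>\<^sup>+u. ennreal (Gamma q * Gamma b / Gamma (q + b)) *
      (ennreal (Gamma (q + b) / (Gamma q * Gamma b) * u powr (q - 1) * (1 - u) powr (b - 1) * indicator {0<..<1} u) *
        ennreal (partition_moment \<alpha> (\<lambda>y. u * f y) n 1)) \<partial>lborel)"
  proof (rule nn_integral_cong)
    fix u :: real
    show "F (1 / u) * ennreal (1 / u\<^sup>2) * indicator {0<..} u = ennreal (Gamma q * Gamma b / Gamma (q + b)) *
      (ennreal (Gamma (q + b) / (Gamma q * Gamma b) * u powr (q - 1) * (1 - u) powr (b - 1) * indicator {0<..<1} u) *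
        ennreal (partition_moment \<alpha> (\<lambda>y. u * f y) n 1))"
    proof (cases "0 < u \<and> u < 1")
      case False
      then show ?thesis by (auto simp: F_def indicator_def)
    next
      case True
      then have u: "0 < u" "u < 1" by auto
      have Gpos: "Gamma q > 0" "Gamma b > 0" "Gamma (q + b) > 0"
        using q b0 by (auto intro!: Gamma_real_pos)
      let ?P = "partition_moment \<alpha> (\<lambda>y. u * f y) n 1"
      have "?P = u powr (- \<theta> - real n) * partition_moment \<alpha> f n (1 / u)"
        using partition_moment_shape_scale[of "1 / u" u n] u by (simp add: \<theta>_def)
      then have "u powr (\<theta> + real n) * ?P = (u powr (\<theta> + real n) * u powr (- \<theta> - real n)) * partition_moment \<alpha> f n (1 / u)"
        by simp
      also have "u powr (\<theta> + real n) * u powr (- \<theta> - real n) = 1" using u by (simp flip: powr_add)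
      finally have P: "partition_moment \<alpha> f n (1 / u) = u powr (\<theta> + real n) * ?P" by simp
      have "1 / u - 1 = (1 - u) / u" using u by (simp add: field_simps)
      then have "(1 / u - 1) powr (b - 1) = (1 - u) powr (b - 1) * u powr (1 - b)"
        using u by (simp add: powr_divide powr_diff)
      moreover have "1 / u\<^sup>2 = u powr (- 2)" using u by (simp add: powr_minus powr_numeral inverse_eq_divide)
      ultimately have "(1 / u - 1) powr (b - 1) * partition_moment \<alpha> f n (1 / u) * (1 / u\<^sup>2) =
          (u powr (1 - b) * u powr (\<theta> + real n) * u powr (- 2)) * (1 - u) powr (b - 1) * ?P"
        by (simp only: P mult_ac)
      also have "u powr (1 - b) * u powr (\<theta> + real n) * u powr (- 2) = u powr (q - 1)"
        by (simp add: b_def flip: powr_add)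
      finally have E: "(1 / u - 1) powr (b - 1) * partition_moment \<alpha> f n (1 / u) * (1 / u\<^sup>2) =
          Gamma q * Gamma b / Gamma (q + b) *
          (Gamma (q + b) / (Gamma q * Gamma b) * u powr (q - 1) * (1 - u) powr (b - 1) * ?P)"
        using Gpos by simp
      have "F (1 / u) * ennreal (1 / u\<^sup>2) * indicator {0<..} u =
          ennreal ((1 / u - 1) powr (b - 1) * partition_moment \<alpha> f n (1 / u) * (1 / u\<^sup>2))"
        using u by (simp add: F_def partition_moment_nonneg flip: ennreal_mult)
      then show ?thesis
        unfolding E using u Gpos by (simp add: partition_moment_nonneg flip: ennreal_mult)
    qed
  qed
  also have "\<dots> = ennreal (Gamma q * Gamma b / Gamma (q + b)) *
      (\<integral>\<^sup>+u. ennreal (Gamma (q + b) / (Gamma q * Gamma b) * u powr (q - 1) * (1 - u) powr (b - 1) * indicator {0<..<1} u) *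
        ennreal (partition_moment \<alpha> (\<lambda>y. u * f y) n 1) \<partial>lborel)"
    by (rule nn_integral_cmult) measurable
  also have "\<dots> = ennreal (Gamma q * Gamma b / Gamma (q + b)) *
      (\<integral>\<^sup>+u. ennreal (partition_moment \<alpha> (\<lambda>y. u * f y) n 1) \<partial>beta_distribution q b)"
    unfolding beta_distribution_def by (subst nn_integral_density) simp_all
  finally have E: "ennreal (Gamma b) * ?R = ennreal (Gamma q * Gamma b / Gamma (q + b)) *
      (\<integral>\<^sup>+u. ennreal (partition_moment \<alpha> (\<lambda>y. u * f y) n 1) \<partial>beta_distribution q b)" (is "_ = _ * ?B") .
  have G: "Gamma q > 0" "Gamma b > 0" "Gamma (\<theta> + real n) > 0"
    using q b0 \<theta>n by (auto intro!: Gamma_real_pos)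
  have "ennreal (Gamma b) * (ennreal (Gamma (\<theta> + real n)) * ?R) =
      ennreal (Gamma (\<theta> + real n)) * (ennreal (Gamma b) * ?R)" by (simp only: mult_ac)
  also have "\<dots> = (ennreal (Gamma (\<theta> + real n)) * ennreal (Gamma q * Gamma b / Gamma (q + b))) * ?B"
    by (simp only: E mult.assoc)
  also have "ennreal (Gamma (\<theta> + real n)) * ennreal (Gamma q * Gamma b / Gamma (q + b)) = ennreal (Gamma b) * ennreal (Gamma q)"
    using G by (simp add: sum mult.commute flip: ennreal_mult)
  finally have "ennreal (Gamma b) * (ennreal (Gamma (\<theta> + real n)) * ?R) = ennreal (Gamma b) * (ennreal (Gamma q) * ?B)"
    by (simp only: mult.assoc)
  then have "ennreal (Gamma (\<theta> + real n)) * ?R = ennreal (Gamma q) * ?B"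
    using G by (simp add: ennreal_mult_cancel_left)
  then show ?thesis by (simp add: \<theta>_def b_def)
qed

end

end

section \<open>Normalisation, the beta-gamma density and the partition sum\<close>

lemma integral_scale_measure:
  fixes f :: "'a \<Rightarrow> real"
  assumes [measurable]: "f \<in> borel_measurable M" and "\<And>x. f x \<ge> 0" and r: "r \<ge> 0"
  shows "(\<integral>x. f x \<partial>scale_measure (ennreal r) M) = r * (\<integral>x. f x \<partial>M)"
  using assms by (simp add: integral_eq_nn_integral nn_integral_scale_measure enn2real_mult)

text \<open>
  The image is boundedly finite even on the exceptional event: if \<open>T = 0\<close> the scaling factor is \<open>\<infinity>\<close>, but
  then \<open>\<mu>\<close> itself vanishes; if \<open>T = \<infinity>\<close> the factor is \<open>0\<close>.
\<close>
lemma measurable_normalize: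
  "(\<lambda>\<mu>. scale_measure (inverse (emeasure \<mu> UNIV)) \<mu>) \<in> measurable bdd_fin_algebra (bdd_fin_algebra :: 'y::polish_space measure measure)"
proof (rule measurable_bdd_fin_algebraI)
  show "(\<lambda>\<mu>. scale_measure (inverse (emeasure \<mu> UNIV)) \<mu>) \<in> space bdd_fin_algebra \<rightarrow> space (bdd_fin_algebra :: 'y measure measure)"
  proof
    fix \<mu> :: "'y measure" assume "\<mu> \<in> space bdd_fin_algebra"
    then have \<mu>: "sets \<mu> = sets borel" "\<And>B. B \<in> sets borel \<Longrightarrow> bounded B \<Longrightarrow> emeasure \<mu> B < \<infinity>"
      by (auto simp: space_bdd_fin_algebra)
    have "inverse (emeasure \<mu> UNIV) * emeasure \<mu> B < \<top>" if B: "B \<in> sets borel" "bounded B" for B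
    proof (cases "emeasure \<mu> UNIV = 0")
      case True
      have "emeasure \<mu> B \<le> emeasure \<mu> UNIV" by (rule emeasure_mono) (auto simp: \<mu>(1))
      then show ?thesis using True by simp
    next
      case False
      then have "inverse (emeasure \<mu> UNIV) < \<top>" by (simp add: less_top[symmetric])
      then show ?thesis using \<mu>(2)[OF B] by (auto simp only: ennreal_mult_less_top infinity_ennreal_def)
    qed
    then show "scale_measure (inverse (emeasure \<mu> UNIV)) \<mu> \<in> space bdd_fin_algebra"
      using \<mu>(1) by (simp add: space_bdd_fin_algebra)
  qed
  show "(\<lambda>\<mu>. emeasure (scale_measure (inverse (emeasure \<mu> UNIV)) \<mu>) A) \<in> borel_measurable (bdd_fin_algebra :: 'y measure measure)"
    if "A \<in> sets borel" for A
    using measurable_emeasure_bdd_fin[OF that] measurable_emeasure_bdd_fin[of UNIV]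
    unfolding emeasure_scale_measure
    by (intro borel_measurable_times_ennreal borel_measurable_inverse_ennreal) simp_all
qed

context gamma_process
begin

text \<open>
  Almost surely \<open>0 < T < \<infinity>\<close>, and there the normalised measure integrates \<open>g\<close> to \<open>\<mu>(g) / T\<close>.
\<close>
lemma integral_dirichlet_law:
  fixes g :: "'y \<Rightarrow> real" and \<phi> :: "real \<Rightarrow> real"
  assumes g [measurable]: "g \<in> borel_measurable borel" and g0: "\<And>y. g y \<ge> 0"
    and \<phi> [measurable]: "\<phi> \<in> borel_measurable borel" and mass: "measure \<alpha> UNIV > 0"
  shows "(\<integral>P. \<phi> (\<integral>y. g y \<partial>P) \<partial>dirichlet_law G) = (\<integral>\<mu>. \<phi> ((\<integral>y. g y \<partial>\<mu>) / measure \<mu> UNIV) \<partial>G)"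
proof -
  have N: "(\<lambda>\<mu>. scale_measure (inverse (emeasure \<mu> UNIV)) \<mu>) \<in> measurable G bdd_fin_algebra"
    using measurable_normalize measurable_cong_sets[OF sets_G refl] by blast
  have I: "(\<lambda>\<mu>. \<integral>y. g y \<partial>\<mu>) \<in> borel_measurable bdd_fin_algebra"
    by (rule measurable_integral_bdd_fin[OF g g0])
  have IG [measurable]: "(\<lambda>\<mu>. \<integral>y. g y \<partial>\<mu>) \<in> borel_measurable G"
    by (rule measurable_integral_G[OF g g0])
  have "(\<integral>P. \<phi> (\<integral>y. g y \<partial>P) \<partial>dirichlet_law G) =
      (\<integral>\<mu>. \<phi> (\<integral>y. g y \<partial>scale_measure (inverse (emeasure \<mu> UNIV)) \<mu>) \<partial>G)"
    unfolding dirichlet_law_def by (rule integral_distr[OF N measurable_compose[OF I \<phi>]])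
  also have "\<dots> = (\<integral>\<mu>. \<phi> ((\<integral>y. g y \<partial>\<mu>) / measure \<mu> UNIV) \<partial>G)"
  proof (rule integral_cong_AE)
    show "AE \<mu> in G. \<phi> (\<integral>y. g y \<partial>scale_measure (inverse (emeasure \<mu> UNIV)) \<mu>) = \<phi> ((\<integral>y. g y \<partial>\<mu>) / measure \<mu> UNIV)"
      using AE_total_mass[OF mass] AE_space
    proof eventually_elim
      case (elim \<mu>)
      have g\<mu>: "g \<in> borel_measurable \<mu>"
        using g measurable_cong_sets[OF space_G[OF elim(2)] refl] by blast
      have m: "ennreal (measure \<mu> UNIV) = emeasure \<mu> UNIV" "measure \<mu> UNIV > 0"
        using elim(1) by (simp_all add: measure_def enn2real_positive_iff)
      have "inverse (emeasure \<mu> UNIV) = ennreal (1 / measure \<mu> UNIV)"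
        unfolding m(1)[symmetric] inverse_ennreal[OF m(2)] by (simp only: inverse_eq_divide)
      then have "(\<integral>y. g y \<partial>scale_measure (inverse (emeasure \<mu> UNIV)) \<mu>) = (\<integral>y. g y \<partial>\<mu>) / measure \<mu> UNIV"
        using integral_scale_measure[OF g\<mu> g0, of "1 / measure \<mu> UNIV"] by simp
      then show ?case by (simp only:)
    qed
    show "(\<lambda>\<mu>. \<phi> (\<integral>y. g y \<partial>scale_measure (inverse (emeasure \<mu> UNIV)) \<mu>)) \<in> borel_measurable G"
      by (rule measurable_compose[OF N measurable_compose[OF I \<phi>]])
    show "(\<lambda>\<mu>. \<phi> ((\<integral>y. g y \<partial>\<mu>) / measure \<mu> UNIV)) \<in> borel_measurable G"
      by (rule measurable_compose[OF borel_measurable_divide[OF IG measurable_total_mass] \<phi>])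
  qed
  finally show ?thesis .
qed

lemma integral_beta_gamma_law:
  fixes g :: "'y \<Rightarrow> real"
  assumes g [measurable]: "g \<in> borel_measurable borel" and g0: "\<And>y. g y \<ge> 0"
    and [measurable]: "\<phi> \<in> borel_measurable borel" and \<theta>: "\<theta> > 0" and q: "q > 0"
  shows "(\<integral>\<mu>. \<phi> (\<integral>y. g y \<partial>\<mu>) \<partial>beta_gamma_law G \<theta> q) =
         (\<integral>\<mu>. Gamma \<theta> / Gamma q * measure \<mu> UNIV powr (q - \<theta>) * \<phi> (\<integral>y. g y \<partial>\<mu>) \<partial>G)"
proof -
  have [measurable]: "(\<lambda>\<mu>. \<integral>y. g y \<partial>\<mu>) \<in> borel_measurable G"
    by (rule measurable_integral_G[OF g g0])
  have "0 \<le> Gamma \<theta>" "0 \<le> Gamma q"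
    using \<theta> q by (simp_all add: Gamma_real_pos less_imp_le)
  then show ?thesis
    unfolding beta_gamma_law_def by (subst integral_density) auto
qed

end

lemma cell_moment_scale_measure:
  assumes [measurable]: "f \<in> borel_measurable H" and "\<theta> \<ge> 0"
  shows "cell_moment (scale_measure (ennreal \<theta>) H) f k v =
         \<theta> * (Gamma (real k) * (\<integral>y. (v + f y) powr (- real k) \<partial>H))"
  unfolding cell_moment_def using assms(2) by (subst integral_scale_measure) auto

text \<open>
  The weight \<open>\<theta>\<^sup>k\<close>, \<open>k\<close> the number of cells, is what distinguishes integration against \<open>\<theta>H\<close> from
  integration against \<open>H\<close>.  Finiteness of the whole sum makes each of its nonnegative terms integrable, so
  that sum and integral can be interchanged.
\<close>
lemma partition_beta_sum_eq:
  fixes H :: "('y::polish_space) measure" and g :: "'y \<Rightarrow> real"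
  defines "\<alpha> \<equiv> \<lambda>\<theta>. scale_measure (ennreal \<theta>) H"
  assumes H: "prob_space H" and sets_H: "sets H = sets borel" and g: "g \<in> borel_measurable borel" and \<theta>: "\<theta> > 0"
    and fin: "(\<integral>\<^sup>+u. ennreal (partition_moment (\<alpha> \<theta>) (\<lambda>y. u * (z * g y)) n 1) \<partial>beta_distribution q (\<theta> + real n - q)) < \<infinity>"
  shows "partition_beta_sum H \<theta> g z q n =
         Gamma \<theta> / Gamma (\<theta> + real n) *
         enn2real (\<integral>\<^sup>+u. ennreal (partition_moment (\<alpha> \<theta>) (\<lambda>y. u * (z * g y)) n 1) \<partial>beta_distribution q (\<theta> + real n - q))"
proof -
  interpret H: prob_space H by fact
  interpret \<alpha>: finite_measure "\<alpha> \<theta>"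
    by (rule finite_measureI) (simp add: \<alpha>_def space_scale_measure H.emeasure_space_1)
  have gH [measurable]: "g \<in> borel_measurable H"
    using g measurable_cong_sets[OF sets_H refl] by blast
  have g\<alpha> [measurable]: "g \<in> borel_measurable (\<alpha> \<theta>)"
    using g measurable_cong_sets[of "\<alpha> \<theta>" borel] sets_H unfolding \<alpha>_def by simp
  define B where "B = beta_distribution q (\<theta> + real n - q)"
  have B_sets [measurable_cong]: "sets B = sets borel" by (simp add: B_def beta_distribution_def)
  define P where "P = {p. partition_on {1..n} p}"
  have P_fin: "finite P" by (simp add: P_def finitely_many_partition_on)
  define c where "c = Gamma \<theta> / Gamma (\<theta> + real n)"
  have c0: "c > 0" using \<theta> by (simp add: c_def Gamma_real_pos add_pos_nonneg)
  define h where "h p u = exp (- (\<integral>y. ln (1 + u * z * g y) \<partial>\<alpha> \<theta>)) *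
      (\<Prod>C\<in>p. \<integral>y. (1 + u * z * g y) powr (- real (card C)) \<partial>H)" for p :: "nat set set" and u :: real
  define m where "m u = partition_moment (\<alpha> \<theta>) (\<lambda>y. u * (z * g y)) n 1" for u
  have m_meas [measurable]: "m \<in> borel_measurable borel"
    unfolding m_def by (rule \<alpha>.measurable_partition_moment[where f = "\<lambda>u y. u * (z * g y)"]) measurable
  have h_meas [measurable]: "h p \<in> borel_measurable borel" for p
    unfolding h_def by measurable
  have m0: "m u \<ge> 0" for u by (simp add: m_def partition_moment_nonneg)
  have h0: "h p u \<ge> 0" for p u
    unfolding h_def by (intro mult_nonneg_nonneg prod_nonneg ballI Bochner_Integration.integral_nonneg) auto
  have w0: "partition_weight \<theta> n p \<ge> 0" if "p \<in> P" for p
    unfolding partition_weight_def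
    using c0 \<theta> that partition_on_cell_card(2)[of n p]
    by (intro mult_nonneg_nonneg prod_nonneg ballI) (auto simp: c_def P_def intro!: less_imp_le[OF Gamma_real_pos])
  have cm: "c * m u = (\<Sum>p\<in>P. partition_weight \<theta> n p * h p u)" for u
  proof -
    have "(\<Prod>C\<in>p. cell_moment (\<alpha> \<theta>) (\<lambda>y. u * (z * g y)) (card C) 1) = \<theta> ^ card p * (\<Prod>C\<in>p. Gamma (real (card C))) *
        (\<Prod>C\<in>p. \<integral>y. (1 + u * z * g y) powr (- real (card C)) \<partial>H)" for p :: "nat set set"
      using \<theta> unfolding \<alpha>_def by (subst cell_moment_scale_measure) (simp_all add: prod.distrib mult.assoc)
    then show ?thesis
      by (simp add: m_def partition_moment_def P_def c_def h_def partition_weight_def sum_distrib_left mult_ac)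
  qed
  have "integrable B m"
  proof (rule integrableI_nonneg)
    show "(\<integral>\<^sup>+u. ennreal (m u) \<partial>B) < \<infinity>" using fin by (simp only: m_def B_def)
  qed (use m0 in auto)
  then have int: "integrable B (\<lambda>u. c * m u)" by simp
  have int_p: "integrable B (\<lambda>u. partition_weight \<theta> n p * h p u)" if p: "p \<in> P" for p
  proof (rule Bochner_Integration.integrable_bound[OF int])
    show "AE u in B. norm (partition_weight \<theta> n p * h p u) \<le> norm (c * m u)"
    proof (rule AE_I2)
      fix u
      have "partition_weight \<theta> n p * h p u \<le> c * m u"
        unfolding cm using p P_fin w0 h0 by (intro member_le_sum) auto
      then show "norm (partition_weight \<theta> n p * h p u) \<le> norm (c * m u)"
        using w0[OF p] h0[of p u] by simp
    qed
  qed measurable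
  have "partition_beta_sum H \<theta> g z q n = (\<Sum>p\<in>P. \<integral>u. partition_weight \<theta> n p * h p u \<partial>B)"
    by (simp add: partition_beta_sum_def P_def h_def B_def \<alpha>_def)
  also have "\<dots> = (\<integral>u. c * m u \<partial>B)"
    unfolding cm using int_p by (rule Bochner_Integration.integral_sum[symmetric])
  also have "\<dots> = c * enn2real (\<integral>\<^sup>+u. ennreal (m u) \<partial>B)"
    using m0 by (simp add: integral_eq_nn_integral)
  finally show ?thesis by (simp add: c_def m_def B_def)
qed

theorem theorem4p1:
  fixes H :: "('y::polish_space) measure"
    and G :: "'y measure measure"
    and g :: "'y \<Rightarrow> real"
    and \<theta> z :: real
  assumes "prob_space H" and "sets H = sets borel" and "non_atomic H"
    and "\<theta> > 0"
    and "gamma_process_law (scale_measure (ennreal \<theta>) H) G"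
    and "g \<in> borel_measurable borel" and "\<And>y. g y > 0"
    and "(\<integral>\<^sup>+ y. ennreal (ln (1 + g y)) \<partial>scale_measure (ennreal \<theta>) H) < \<infinity>"
    and "z \<ge> 0"
  shows
    "(\<forall>q>0.
        (\<integral>P. (1 + z * (\<integral>y. g y \<partial>P)) powr (- q) \<partial>dirichlet_law G) =
        (\<integral>\<mu>. exp (- z * (\<integral>y. g y \<partial>\<mu>)) \<partial>beta_gamma_law G \<theta> q))
     \<and> (\<forall>q>0. \<forall>n::nat. \<theta> + real n - q > 0 \<longrightarrow>
          (\<integral>P. (1 + z * (\<integral>y. g y \<partial>P)) powr (- q) \<partial>dirichlet_law G) =
            partition_beta_sum H \<theta> g z q n
        \<and> (\<integral>\<mu>. exp (- z * (\<integral>y. g y \<partial>\<mu>)) \<partial>beta_gamma_law G \<theta> q) =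
            partition_beta_sum H \<theta> g z q n)
     \<and> (\<forall>n\<ge>1.
          (\<integral>\<mu>. exp (- z * (\<integral>y. g y \<partial>\<mu>)) \<partial>G) = partition_beta_sum H \<theta> g z \<theta> n)
     \<and> (\<forall>q>0. \<theta> - q > 0 \<longrightarrow>
          (\<integral>P. (1 + z * (\<integral>y. g y \<partial>P)) powr (- q) \<partial>dirichlet_law G) =
          (\<integral>u. exp (- (\<integral>y. ln (1 + u * z * g y) \<partial>scale_measure (ennreal \<theta>) H))
             \<partial>beta_distribution q (\<theta> - q)))"
proof -
  define \<alpha> where "\<alpha> = scale_measure (ennreal \<theta>) H"
  interpret H: prob_space H by fact
  have space_H: "space H = UNIV" using sets_eq_imp_space_eq[OF assms(2)] by simp
  interpret gamma_process \<alpha> G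
  proof (intro gamma_process.intro gamma_process_axioms.intro)
    show "finite_measure \<alpha>"
      by (rule finite_measureI) (simp add: \<alpha>_def space_scale_measure H.emeasure_space_1)
  qed (use assms(2,5) in \<open>simp_all add: \<alpha>_def\<close>)
  have mass: "measure \<alpha> UNIV = \<theta>"
    using assms(4) H.prob_space by (simp add: \<alpha>_def space_H)
  note mass_pos = assms(4)[folded mass]
  have g0: "g y \<ge> 0" for y using assms(7)[of y] by simp
  define f where "f = (\<lambda>y. z * g y)"
  have f_meas [measurable]: "f \<in> borel_measurable borel"
    unfolding f_def by (rule borel_measurable_times[OF borel_measurable_const assms(6)])
  have f0: "f y \<ge> 0" for y using g0[of y] assms(9) by (simp add: f_def)
  have g\<alpha>: "g \<in> borel_measurable \<alpha>"
    using assms(6) measurable_cong_sets[OF sets_shape refl] by blast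
  have "integrable \<alpha> (\<lambda>y. ln (1 + g y))"
  proof (rule integrableI_nonneg)
    show "(\<integral>\<^sup>+y. ennreal (ln (1 + g y)) \<partial>\<alpha>) < \<infinity>" unfolding \<alpha>_def by (rule assms(8))
    show "AE y in \<alpha>. 0 \<le> ln (1 + g y)"
      by (rule AE_I2, rule ln_ge_zero) (simp add: g0)
    show "(\<lambda>y. ln (1 + g y)) \<in> borel_measurable \<alpha>"
      by (rule borel_measurable_ln[OF borel_measurable_add[OF borel_measurable_const g\<alpha>]])
  qed
  then have int: "integrable \<alpha> (\<lambda>y. ln (1 + f y))"
    unfolding f_def using integrable_ln_affine[OF finite_measure_axioms g\<alpha> g0, of 1 z] assms(9) by simp
  note process = f_meas f0 int mass_pos
  have fI [measurable]: "(\<lambda>\<mu>. \<integral>y. f y \<partial>\<mu>) \<in> borel_measurable G"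
    by (rule measurable_integral_G[OF f_meas f0])
  have fI0: "0 \<le> (\<integral>y. f y \<partial>\<mu>)" for \<mu>
    using f0 by (intro Bochner_Integration.integral_nonneg)
  define L where "L q = (\<integral>P. (1 + z * (\<integral>y. g y \<partial>P)) powr (- q) \<partial>dirichlet_law G)" for q
  define R where "R q = (\<integral>\<mu>. exp (- z * (\<integral>y. g y \<partial>\<mu>)) \<partial>beta_gamma_law G \<theta> q)" for q
  define A where "A q = (\<integral>\<^sup>+\<mu>. ennreal ((1 + (\<integral>y. f y \<partial>\<mu>) / measure \<mu> UNIV) powr (- q)) \<partial>G)" for q
  define B where "B q = (\<integral>\<^sup>+\<mu>. ennreal (measure \<mu> UNIV powr (q - \<theta>)) * ennreal (exp (- (\<integral>y. f y \<partial>\<mu>))) \<partial>G)" for q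
  have L: "L q = enn2real (A q)" if "q > 0" for q
  proof -
    have "L q = (\<integral>\<mu>. (1 + (\<integral>y. f y \<partial>\<mu>) / measure \<mu> UNIV) powr (- q) \<partial>G)"
      unfolding L_def f_def
      by (subst integral_dirichlet_law[where \<phi> = "\<lambda>x. (1 + z * x) powr (- q)"]) (use assms(6) g0 mass_pos in auto)
    then show ?thesis by (simp add: integral_eq_nn_integral A_def)
  qed
  have R_G: "R q = (\<integral>\<mu>. Gamma \<theta> / Gamma q * measure \<mu> UNIV powr (q - \<theta>) * exp (- (\<integral>y. f y \<partial>\<mu>)) \<partial>G)"
    if "q > 0" for q
    unfolding R_def f_def
    by (subst integral_beta_gamma_law[where \<phi> = "\<lambda>x. exp (- z * x)"]) (use assms(6) g0 assms(4) that in auto)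
  have R: "R q = enn2real (ennreal (Gamma \<theta> / Gamma q) * B q)" if q: "q > 0" for q
  proof -
    define c where "c = Gamma \<theta> / Gamma q"
    have c: "c \<ge> 0" using assms(4) q by (simp add: c_def Gamma_real_pos less_imp_le)
    have "ennreal c * B q =
        (\<integral>\<^sup>+\<mu>. ennreal c * (ennreal (measure \<mu> UNIV powr (q - \<theta>)) * ennreal (exp (- (\<integral>y. f y \<partial>\<mu>)))) \<partial>G)"
      unfolding B_def by (rule nn_integral_cmult[symmetric]) measurable
    also have "\<dots> = (\<integral>\<^sup>+\<mu>. ennreal (c * measure \<mu> UNIV powr (q - \<theta>) * exp (- (\<integral>y. f y \<partial>\<mu>))) \<partial>G)"
      using c by (intro nn_integral_cong) (simp add: ennreal_mult mult.assoc)
    finally show ?thesis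
      unfolding R_G[OF q] c_def[symmetric] using c by (subst integral_eq_nn_integral) auto
  qed
  have AB: "ennreal (Gamma q) * A q = ennreal (Gamma \<theta>) * B q" if "q > 0" for q
    using nn_ratio_identity[OF process that] by (simp add: A_def B_def mass)
  have A_B: "A q = ennreal (Gamma \<theta> / Gamma q) * B q" if q: "q > 0" for q
  proof -
    have G: "Gamma q > 0" "Gamma \<theta> > 0" using q assms(4) by (auto intro: Gamma_real_pos)
    have "ennreal (Gamma q) * (ennreal (Gamma \<theta> / Gamma q) * B q) = ennreal (Gamma \<theta>) * B q"
      using G by (simp add: mult.assoc[symmetric] flip: ennreal_mult)
    with AB[OF q] have "ennreal (Gamma q) * A q = ennreal (Gamma q) * (ennreal (Gamma \<theta> / Gamma q) * B q)" by simp
    then show ?thesis using G by (simp add: ennreal_mult_cancel_left)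
  qed
  have LR: "L q = R q" if "q > 0" for q using L[OF that] R[OF that] A_B[OF that] by simp
  have A_le: "A q \<le> 1" if "q > 0" for q
  proof -
    have "A q \<le> (\<integral>\<^sup>+\<mu>. 1 \<partial>G)"
      unfolding A_def
    proof (rule nn_integral_mono)
      fix \<mu>
      have "(1 + (\<integral>y. f y \<partial>\<mu>) / measure \<mu> UNIV) powr (- q) \<le> (1 + (\<integral>y. f y \<partial>\<mu>) / measure \<mu> UNIV) powr 0"
        using that fI0[of \<mu>] by (intro powr_mono) (auto intro!: divide_nonneg_nonneg)
      also have "\<dots> \<le> 1" by simp
      finally show "ennreal ((1 + (\<integral>y. f y \<partial>\<mu>) / measure \<mu> UNIV) powr (- q)) \<le> 1" by simp
    qed
    then show ?thesis by (simp add: G.emeasure_space_1)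
  qed
  \<comment> \<open>Cancelling \<open>\<Gamma>(q)\<close> between the two identities eliminates \<open>B\<close>; the bound \<open>A q \<le> 1\<close> keeps everything finite.\<close>
  have LP: "L q = partition_beta_sum H \<theta> g z q n" if q: "q > 0" and b: "\<theta> + real n - q > 0" for q n
  proof -
    define D where "D = (\<integral>\<^sup>+u. ennreal (partition_moment \<alpha> (\<lambda>y. u * (z * g y)) n 1) \<partial>beta_distribution q (\<theta> + real n - q))"
    have G: "Gamma q > 0" "Gamma \<theta> > 0" "Gamma (\<theta> + real n) > 0"
      using q assms(4) by (auto intro!: Gamma_real_pos add_pos_nonneg)
    have BD: "ennreal (Gamma (\<theta> + real n)) * B q = ennreal (Gamma q) * D"
      using nn_partition_identity[OF process q, of n] b by (simp add: B_def D_def mass f_def)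
    have "ennreal (Gamma q) * (ennreal (Gamma (\<theta> + real n)) * A q) =
        ennreal (Gamma \<theta>) * (ennreal (Gamma (\<theta> + real n)) * B q)"
      by (subst mult.left_commute, subst AB[OF q], rule mult.left_commute)
    also have "\<dots> = ennreal (Gamma q) * (ennreal (Gamma \<theta>) * D)"
      unfolding BD by (rule mult.left_commute)
    finally have AD: "ennreal (Gamma (\<theta> + real n)) * A q = ennreal (Gamma \<theta>) * D"
      using G by (simp add: ennreal_mult_cancel_left)
    have "A q < \<top>" using A_le[OF q] by (rule le_less_trans) simp
    then have "ennreal (Gamma \<theta>) * D < \<top>" unfolding AD[symmetric] by (simp add: ennreal_mult_less_top)
    then have D: "D < \<infinity>" using G by (auto simp: ennreal_mult_less_top)
    have "Gamma (\<theta> + real n) * enn2real (A q) = Gamma \<theta> * enn2real D"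
      using arg_cong[OF AD, of enn2real] G by (simp add: enn2real_mult)
    then have "enn2real (A q) = Gamma \<theta> / Gamma (\<theta> + real n) * enn2real D"
      using G by (simp add: field_simps)
    then show ?thesis
      unfolding L[OF q]
      using partition_beta_sum_eq[OF assms(1,2,6,4), where z = z and q = q and n = n] D unfolding D_def \<alpha>_def by simp
  qed
  have R\<theta>: "R \<theta> = (\<integral>\<mu>. exp (- z * (\<integral>y. g y \<partial>\<mu>)) \<partial>G)"
  proof -
    have nz: "Gamma \<theta> \<noteq> 0" using Gamma_real_pos[OF assms(4)] by simp
    have ae: "AE \<mu> in G. Gamma \<theta> / Gamma \<theta> * measure \<mu> UNIV powr (\<theta> - \<theta>) * exp (- (\<integral>y. f y \<partial>\<mu>)) =
        exp (- (\<integral>y. f y \<partial>\<mu>))"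
      using AE_measure_pos[OF mass_pos] by eventually_elim (simp add: nz)
    have "R \<theta> = (\<integral>\<mu>. exp (- (\<integral>y. f y \<partial>\<mu>)) \<partial>G)"
      unfolding R_G[OF assms(4)] by (rule integral_cong_AE[OF _ _ ae]) simp_all
    then show ?thesis by (simp add: f_def)
  qed
  have P0: "partition_beta_sum H \<theta> g z q 0 =
      (\<integral>u. exp (- (\<integral>y. ln (1 + u * z * g y) \<partial>scale_measure (ennreal \<theta>) H)) \<partial>beta_distribution q (\<theta> - q))" for q
    using Gamma_real_pos[OF assms(4)]
    by (simp add: partition_beta_sum_def partition_weight_def partition_on_empty)
  have i: "\<forall>q>0. L q = R q" using LR by blast
  have ii: "\<forall>q>0. \<forall>n. \<theta> + real n - q > 0 \<longrightarrow> L q = partition_beta_sum H \<theta> g z q n \<and> R q = partition_beta_sum H \<theta> g z q n"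
    using LP LR by simp
  have ii': "\<forall>n\<ge>1. (\<integral>\<mu>. exp (- z * (\<integral>y. g y \<partial>\<mu>)) \<partial>G) = partition_beta_sum H \<theta> g z \<theta> n"
    using ii assms(4) unfolding R\<theta>[symmetric] by auto
  have iii: "\<forall>q>0. \<theta> - q > 0 \<longrightarrow> L q =
      (\<integral>u. exp (- (\<integral>y. ln (1 + u * z * g y) \<partial>scale_measure (ennreal \<theta>) H)) \<partial>beta_distribution q (\<theta> - q))"
    using LP[of _ 0] unfolding P0 by simp
  show ?thesis
    using i ii ii' iii unfolding L_def R_def by (intro conjI)
qed

end
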